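(* Let $G,H$ be finite graphs. There exists a $\mathbb{Z}_2$-map from $|\mathrm{B}(G)|$ to $|\mathrm{B}(H)|$ if and only if, for some odd positive integer $k$, there is a graph homomorphism $\Omega_k(G)\to H$. Moreover, if $G$ and $H$ have no loops, then for every $\mathbb{Z}_2$-map $f\colon|\mathrm{B}(G)|\to|\mathrm{B}(H)|$ there is an odd $k$ and a homomorphism $h\colon\Omega_k(G)\to H$ such that the induced map $|h|$ is $\mathbb{Z}_2$-homotopic to $f\circ|p_k|$.
   Context: A graph $G$ is a finite vertex set $V(G)$ with a symmetric adjacency relation (loops allowed). For $A,B\subseteq V(G)$ write $A\bowtie B$ if every vertex of $A$ is adjacent to every vertex of $B$; $\mathrm{CN}(A)=\bigcap_{v\in A}N(v)$ is the common neighbourhood ($\mathrm{CN}(\emptyset)=V(G)$). A homomorphism $G\to H$ is a map $V(G)\to V(H)$ preserving adjacency. For $k=2\ell+1$, $\Omega_k(G)$ has vertices the tuples $\mathbf{A}=(A_0,\dots,A_\ell)$ of subsets of $V(G)$ with $|A_0|=1$ and $A_{i-1}\bowtie A_i$ ($i=1,\dots,\ell$); $\mathbf{A},\mathbf{B}$ are adjacent iff $A_{i-1}\subseteq B_i$, $B_{i-1}\subseteq A_i$ ($i=1,\dots,\ell$) and $A_\ell\bowtie B_\ell$. The homomorphism $p_k\colon\Omega_k(G)\to G$ maps $(\{v\},A_1,\dots,A_\ell)\mapsto v$. Box complex: after deleting isolated vertices of $G$, $\mathrm{B}(G)$ is the simplicial complex on $V(G)\times\{\circ,\bullet\}$ whose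 simplices are the nonempty $\sigma$ with $\sigma^\circ\bowtie\sigma^\bullet$ and $\mathrm{CN}(\sigma^\circ),\mathrm{CN}(\sigma^\bullet)\neq\emptyset$, where $\sigma^\circ=\{v:v^\circ\in\sigma\}$, $\sigma^\bullet=\{v:v^\bullet\in\sigma\}$; the $\mathbb{Z}_2$-action swaps $v^\circ\leftrightarrow v^\bullet$. $|\mathrm{B}(G)|$ is the geometric realization with the induced linear involution. A homomorphism $h$ induces $|h|$, the linear extension of $v^\circ\mapsto h(v)^\circ$, $v^\bullet\mapsto h(v)^\bullet$. A $\mathbb{Z}_2$-map is a continuous map commuting with the involutions; $\mathbb{Z}_2$-homotopic means homotopic through $\mathbb{Z}_2$-maps.
   Formalization: The formal statement assumes that if H has no vertices then G has none; otherwise the claim fails, e.g. for H empty and G a single vertex without edges, where the empty map is a Z_2-map but no Omega_k(G) has a homomorphism to H. *)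

theory Defs
  imports "HOL-Analysis.Analysis" "Graph_Theory.Pair_Digraph"
begin

text \<open>
  Finite graphs with loops allowed are the \<^locale>\<open>pair_pseudo_graph\<close>s; for these, adjacency is
  membership in the finite symmetric relation \<^const>\<open>parcs\<close>.
\<close>

section \<open>Graphs\<close>

definition graph_hom :: "'a pair_pre_digraph \<Rightarrow> 'b pair_pre_digraph \<Rightarrow> ('a \<Rightarrow> 'b) \<Rightarrow> bool" where
  "graph_hom G H h \<longleftrightarrow>
     h ` pverts G \<subseteq> pverts H \<and> (\<forall>u v. (u, v) \<in> parcs G \<longrightarrow> (h u, h v) \<in> parcs H)"

definition joined :: "'a pair_pre_digraph \<Rightarrow> 'a set \<Rightarrow> 'a set \<Rightarrow> bool" where
  "joined G A B \<longleftrightarrow> (\<forall>a\<in>A. \<forall>b\<in>B. (a, b) \<in> parcs G)"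

definition CN :: "'a pair_pre_digraph \<Rightarrow> 'a set \<Rightarrow> 'a set" where
  "CN G A = {u \<in> pverts G. \<forall>v\<in>A. (v, u) \<in> parcs G}"

text \<open>Deleting isolated vertices removes no arcs. A vertex carrying a loop is not isolated.\<close>

definition del_isolated :: "'a pair_pre_digraph \<Rightarrow> 'a pair_pre_digraph" where
  "del_isolated G = \<lparr>pverts = {v \<in> pverts G. \<exists>u. (v, u) \<in> parcs G}, parcs = parcs G\<rparr>"


section \<open>The graphs \<open>\<Omega>\<^sub>k(G)\<close>\<close>

text \<open>
  For odd \<open>k\<close>, the number \<open>l = k div 2\<close> satisfies \<open>k = 2 * l + 1\<close>; the definitions are only meant
  for odd \<open>k\<close>. The tuple \<open>(A\<^sub>0, \<dots>, A\<^sub>l)\<close> is the list \<open>[A\<^sub>0, \<dots>, A\<^sub>l]\<close>.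
\<close>

definition Omega_verts :: "nat \<Rightarrow> 'a pair_pre_digraph \<Rightarrow> 'a set list set" where
  "Omega_verts k G = (let l = k div 2 in
     {A. length A = l + 1 \<and> (\<forall>i\<le>l. A ! i \<subseteq> pverts G) \<and> card (A ! 0) = 1 \<and>
         (\<forall>i\<in>{1..l}. joined G (A ! (i - 1)) (A ! i))})"

definition Omega :: "nat \<Rightarrow> 'a pair_pre_digraph \<Rightarrow> 'a set list pair_pre_digraph" where
  "Omega k G = (let l = k div 2 in
     \<lparr>pverts = Omega_verts k G,
      parcs = {(A, B). A \<in> Omega_verts k G \<and> B \<in> Omega_verts k G \<and>
        (\<forall>i\<in>{1..l}. A ! (i - 1) \<subseteq> B ! i \<and> B ! (i - 1) \<subseteq> A ! i) \<and> joined G (A ! l) (B ! l)}\<rparr>)"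

text \<open>The homomorphism \<open>p\<^sub>k\<close>; its defining expression does not involve \<open>k\<close> or the graph.\<close>

definition Omega_proj :: "'a set list \<Rightarrow> 'a" where
  "Omega_proj A = the_elem (A ! 0)"


section \<open>Geometric realization of finite abstract simplicial complexes\<close>

text \<open>
  A complex is given by its set of nonempty finite simplices. Points of the realization are written
  in barycentric coordinates. For a complex with finitely many vertices, all points
  vanish outside a fixed finite set, so that the topology of pointwise convergence used here (the
  product topology on the function type) is the usual topology of the realization.
\<close>

definition realization :: "'v set set \<Rightarrow> ('v \<Rightarrow> real) topology" where
  "realization K = top_of_set
     {x. (\<forall>v. 0 \<le> x v) \<and> {v. x v \<noteq> 0} \<in> K \<and> (\<Sum>v | x v \<noteq> 0. x v) = 1}"

text \<open>Linear extension of a vertex map: the weight of \<open>w\<close> is the total weight of its preimages.\<close>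

definition linear_ext :: "('v \<Rightarrow> 'w) \<Rightarrow> ('v \<Rightarrow> real) \<Rightarrow> 'w \<Rightarrow> real" where
  "linear_ext \<phi> x = (\<lambda>w. \<Sum>v | x v \<noteq> 0 \<and> \<phi> v = w. x v)"


section \<open>The box complex\<close>

text \<open>The vertex \<open>v\<^sup>\<circ>\<close> is encoded as \<open>(v, False)\<close> and \<open>v\<^sup>\<bullet>\<close> as \<open>(v, True)\<close>.\<close>

definition side :: "bool \<Rightarrow> ('a \<times> bool) set \<Rightarrow> 'a set" where
  "side b \<sigma> = {v. (v, b) \<in> \<sigma>}"

definition box_complex :: "'a pair_pre_digraph \<Rightarrow> ('a \<times> bool) set set" where
  "box_complex G = (let G' = del_isolated G in
     {\<sigma>. \<sigma> \<subseteq> pverts G' \<times> UNIV \<and> \<sigma> \<noteq> {} \<and> joined G' (side False \<sigma>) (side True \<sigma>) \<and>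
         CN G' (side False \<sigma>) \<noteq> {} \<and> CN G' (side True \<sigma>) \<noteq> {}})"

definition box_space :: "'a pair_pre_digraph \<Rightarrow> ('a \<times> bool \<Rightarrow> real) topology" where
  "box_space G = realization (box_complex G)"

definition box_inv :: "('a \<times> bool \<Rightarrow> real) \<Rightarrow> ('a \<times> bool \<Rightarrow> real)" where
  "box_inv = linear_ext (\<lambda>(v, b). (v, \<not> b))"

definition box_map :: "('a \<Rightarrow> 'b) \<Rightarrow> ('a \<times> bool \<Rightarrow> real) \<Rightarrow> ('b \<times> bool \<Rightarrow> real)" where
  "box_map h = linear_ext (\<lambda>(v, b). (h v, b))"


section \<open>\<open>\<int>\<^sub>2\<close>-maps\<close>

text \<open>A \<open>\<int>\<^sub>2\<close>-space is a topology together with an involution on its underlying set.\<close>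

definition Z2_map ::
    "'x topology \<Rightarrow> ('x \<Rightarrow> 'x) \<Rightarrow> 'y topology \<Rightarrow> ('y \<Rightarrow> 'y) \<Rightarrow> ('x \<Rightarrow> 'y) \<Rightarrow> bool" where
  "Z2_map X \<alpha> Y \<beta> f \<longleftrightarrow> continuous_map X Y f \<and> (\<forall>x\<in>topspace X. f (\<alpha> x) = \<beta> (f x))"

definition Z2_homotopic ::
    "'x topology \<Rightarrow> ('x \<Rightarrow> 'x) \<Rightarrow> 'y topology \<Rightarrow> ('y \<Rightarrow> 'y) \<Rightarrow> ('x \<Rightarrow> 'y) \<Rightarrow> ('x \<Rightarrow> 'y) \<Rightarrow> bool" where
  "Z2_homotopic X \<alpha> Y \<beta> f g \<longleftrightarrow> homotopic_with (Z2_map X \<alpha> Y \<beta>) X Y f g"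

abbreviation box_Z2_map ::
    "'a pair_pre_digraph \<Rightarrow> 'b pair_pre_digraph \<Rightarrow> (('a \<times> bool \<Rightarrow> real) \<Rightarrow> ('b \<times> bool \<Rightarrow> real)) \<Rightarrow> bool" where
  "box_Z2_map G H \<equiv> Z2_map (box_space G) box_inv (box_space H) box_inv"

abbreviation box_Z2_homotopic ::
    "'a pair_pre_digraph \<Rightarrow> 'b pair_pre_digraph \<Rightarrow> (('a \<times> bool \<Rightarrow> real) \<Rightarrow> ('b \<times> bool \<Rightarrow> real)) \<Rightarrow>
     (('a \<times> bool \<Rightarrow> real) \<Rightarrow> ('b \<times> bool \<Rightarrow> real)) \<Rightarrow> bool" where
  "box_Z2_homotopic G H \<equiv> Z2_homotopic (box_space G) box_inv (box_space H) box_inv"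

end

theory Submission
  imports Defs
begin

text \<open>
  Every \<open>\<int>\<^sub>2\<close>-map into \<open>|B(H)|\<close> can be deformed so that both sides of each value have some
  coordinate above a uniform bound \<open>\<delta>\<close>. Taking superlevel sets for decreasing thresholds
  below \<open>\<delta>\<close> then turns a point of \<open>|B(G)|\<close> into tuples \<open>(A\<^sub>0, \<dots>, A\<^sub>l)\<close>, which gives a \<open>\<int>\<^sub>2\<close>-map
  \<open>|B(G)| \<rightarrow> |B(\<Omega>\<^sub>k(G))|\<close>. Conversely, averaging the sets of a tuple gives a \<open>\<int>\<^sub>2\<close>-map \<open>s\<close> from
  \<open>|B(\<Omega>\<^sub>k(G))|\<close> to \<open>|B(G)|\<close> that is homotopic to \<open>|p\<^sub>k|\<close> and whose images of simplices have diameter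
  \<open>O(1/k)\<close>. By uniform continuity, for large \<open>k\<close> a vertex \<open>h(A)\<close> whose coordinate at the deformed \<open>f (s A)\<close>
  exceeds \<open>\<delta>\<close> is still in the support of the values at all points of the simplices containing \<open>A\<close>;
  so \<open>h\<close> is a homomorphism, and \<open>|h|\<close> is linearly homotopic to the deformed \<open>f \<circ> s\<close>.
\<close>

section \<open>Points of the box complex\<close>

abbreviation box_pts :: "'a pair_pre_digraph \<Rightarrow> ('a \<times> bool \<Rightarrow> real) set" where
  "box_pts G \<equiv> topspace (box_space G)"

lemma box_pts_def:
  "box_pts G = {x. (\<forall>p. 0 \<le> x p) \<and> {p. x p \<noteq> 0} \<in> box_complex G \<and> (\<Sum>p | x p \<noteq> 0. x p) = 1}"
  by (simp add: box_space_def realization_def)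

lemma box_space_eq: "box_space G = top_of_set (box_pts G)"
  unfolding box_space_def realization_def by (simp only: topspace_euclidean_subtopology)

lemma box_Z2_map_iff:
  "box_Z2_map G H f \<longleftrightarrow>
     continuous_on (box_pts G) f \<and> (\<forall>x\<in>box_pts G. f x \<in> box_pts H) \<and>
     (\<forall>x\<in>box_pts G. f (box_inv x) = box_inv (f x))"
proof -
  \<comment> \<open>Stated for abstract \<open>X\<close> and \<open>Y\<close>:
    \<open>box_pts\<close> unfolds to \<open>topspace (box_space _)\<close>, so rewriting with
    \<open>box_space_eq\<close> itself would loop.\<close>
  have "continuous_map X Y f \<longleftrightarrow> continuous_on S f \<and> (\<forall>x\<in>S. f x \<in> T)"
    if "X = top_of_set S" "Y = top_of_set T" for X Y S T
    using that by (auto simp: continuous_map_in_subtopology)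
  from this[OF box_space_eq[of G] box_space_eq[of H]] show ?thesis
    by (auto simp: Z2_map_def)
qed

lemma box_inv_apply [simp]: "box_inv x (v, b) = x (v, \<not> b)"
proof -
  have "(\<lambda>(v, b). (v, \<not> b)) p = (v, b) \<longleftrightarrow> p = (v, \<not> b)" for p :: "'a \<times> bool"
    by (cases p) auto
  then have "{p. x p \<noteq> 0 \<and> (\<lambda>(v, b). (v, \<not> b)) p = (v, b)} =
      (if x (v, \<not> b) = 0 then {} else {(v, \<not> b)})"
    by auto
  then show ?thesis
    unfolding box_inv_def linear_ext_def by (simp only:) simp
qed

context pair_pseudo_graph
begin

text \<open>A one-sided simplex is completed by its common neighbourhood, so that all simplices are
  subsets of complete bipartite pairs with both sides nonempty.\<close>

lemma box_complex_iff:
  "\<sigma> \<in> box_complex G \<longleftrightarrow>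
     \<sigma> \<noteq> {} \<and> (\<exists>W. W False \<noteq> {} \<and> W True \<noteq> {} \<and> joined G (W False) (W True) \<and>
       (\<forall>(v, b)\<in>\<sigma>. v \<in> W b))"
  (is "_ \<longleftrightarrow> ?R")
proof
  assume s: "\<sigma> \<in> box_complex G"
  then have ne: "\<sigma> \<noteq> {}" and j: "joined G (side False \<sigma>) (side True \<sigma>)"
    and cF: "CN (del_isolated G) (side False \<sigma>) \<noteq> {}" and cT: "CN (del_isolated G) (side True \<sigma>) \<noteq> {}"
    by (auto simp: box_complex_def Let_def joined_def del_isolated_def)
  have jF: "joined G (side False \<sigma>) (CN (del_isolated G) (side False \<sigma>))"
    by (auto simp: joined_def CN_def del_isolated_def)
  have jT: "joined G (CN (del_isolated G) (side True \<sigma>)) (side True \<sigma>)"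
    by (auto simp: joined_def CN_def del_isolated_def intro: arcs_symmetric)
  have R: ?R if "A \<noteq> {}" "B \<noteq> {}" "joined G A B" "side False \<sigma> \<subseteq> A" "side True \<sigma> \<subseteq> B" for A B
  proof -
    have "v \<in> (if b then B else A)" if "(v, b) \<in> \<sigma>" for v b
      using that \<open>side False \<sigma> \<subseteq> A\<close> \<open>side True \<sigma> \<subseteq> B\<close> by (cases b) (auto simp: side_def)
    then have "\<forall>(v, b)\<in>\<sigma>. v \<in> (if b then B else A)" by blast
    with ne that(1-3) show ?thesis by (intro conjI exI[of _ "\<lambda>b. if b then B else A"]) simp_all
  qed
  from ne have ne': "side False \<sigma> \<noteq> {} \<or> side True \<sigma> \<noteq> {}"
    by (auto simp: side_def) (metis (full_types))
  show ?R
  proof (cases "side False \<sigma> = {}")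
    case True
    with ne' show ?thesis by (intro R[OF cT _ jT]) auto
  next
    case False
    show ?thesis
    proof (cases "side True \<sigma> = {}")
      case True
      then show ?thesis by (intro R[OF False cF jF]) auto
    next
      case nonempty: False
      show ?thesis by (rule R[OF False nonempty j]) auto
    qed
  qed
next
  assume ?R
  then obtain W where ne: "\<sigma> \<noteq> {}" and W: "W False \<noteq> {}" "W True \<noteq> {}"
    and j: "joined G (W False) (W True)" and m: "\<And>v b. (v, b) \<in> \<sigma> \<Longrightarrow> v \<in> W b"
    by (elim conjE exE) (metis (no_types, lifting) case_prodD)
  have arc: "(u, v) \<in> parcs G" "(v, u) \<in> parcs G" if "u \<in> W False" "v \<in> W True" for u v
    using j that arcs_symmetric by (auto simp: joined_def)
  \<comment> \<open>A vertex of \<open>W b\<close> has a neighbour in the nonempty opposite set, so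
    it survives the deletion of isolated vertices.\<close>
  have noniso: "v \<in> pverts (del_isolated G)" if "v \<in> W b" for v b
  proof (cases b)
    case True
    obtain u where "u \<in> W False" using W by blast
    then show ?thesis using arc[of u v] that True in_arcsD1 by (auto simp: del_isolated_def)
  next
    case False
    obtain u where "u \<in> W True" using W by blast
    then show ?thesis using arc[of v u] that False in_arcsD1 by (auto simp: del_isolated_def)
  qed
  have "W True \<subseteq> CN (del_isolated G) (side False \<sigma>)" "W False \<subseteq> CN (del_isolated G) (side True \<sigma>)"
    using noniso arc m by (auto simp: CN_def side_def) (auto simp: del_isolated_def)
  moreover have "joined G (side False \<sigma>) (side True \<sigma>)"
    using j m by (auto simp: joined_def side_def)
  moreover have "\<sigma> \<subseteq> pverts (del_isolated G) \<times> UNIV" using m noniso by auto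
  ultimately show "\<sigma> \<in> box_complex G"
    using W ne by (auto simp: box_complex_def Let_def joined_def del_isolated_def)
qed

lemma joined_bool:
  assumes "joined G (W False) (W True)" "u \<in> W b" "v \<in> W (\<not> b)"
  shows "(u, v) \<in> parcs G"
  using assms arcs_symmetric by (cases b) (auto simp: joined_def)

lemma box_complexE:
  assumes "\<sigma> \<in> box_complex G"
  obtains W where "\<And>b. W b \<noteq> {}" "joined G (W False) (W True)" "\<And>v b. (v, b) \<in> \<sigma> \<Longrightarrow> v \<in> W b"
    "\<And>b. W b \<subseteq> pverts G"
proof -
  obtain W where W: "W False \<noteq> {}" "W True \<noteq> {}" "joined G (W False) (W True)"
    and s: "\<forall>(v, b)\<in>\<sigma>. v \<in> W b"
    using assms by (auto simp: box_complex_iff)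
  have ne: "W b \<noteq> {}" for b using W by (cases b) auto
  have "W b \<subseteq> pverts G" for b
  proof
    fix v assume "v \<in> W b"
    moreover obtain u where "u \<in> W (\<not> b)" using ne by blast
    ultimately show "v \<in> pverts G" using W(3) joined_bool in_arcsD1 by metis
  qed
  moreover have "v \<in> W b" if "(v, b) \<in> \<sigma>" for v b using s that by blast
  ultimately show thesis using that[of W] ne W(3) by blast
qed

lemma box_complex_subset:
  assumes "\<sigma> \<in> box_complex G" "\<tau> \<subseteq> \<sigma>" "\<tau> \<noteq> {}"
  shows "\<tau> \<in> box_complex G"
  using assms unfolding box_complex_iff by (meson subsetD)

lemma box_complex_verts: "\<sigma> \<in> box_complex G \<Longrightarrow> \<sigma> \<subseteq> pverts G \<times> UNIV"
  by (erule box_complexE) fast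

lemma finite_box_verts: "finite (pverts G \<times> (UNIV :: bool set))"
  using pair_finite_verts by simp

section \<open>Coordinates of points of the realization\<close>

lemma box_pts_supp:
  assumes "x \<in> box_pts G" shows "{p. x p \<noteq> 0} \<subseteq> pverts G \<times> UNIV"
  using assms by (intro box_complex_verts) (simp add: box_pts_def)

lemma box_pts_outside: "x \<in> box_pts G \<Longrightarrow> p \<notin> pverts G \<times> UNIV \<Longrightarrow> x p = 0"
  using box_pts_supp by fastforce

lemma box_pts_nonneg: "x \<in> box_pts G \<Longrightarrow> 0 \<le> x p"
  by (cases p) (simp add: box_pts_def)

text \<open>The index set of the sum no longer depends on the point, which makes the total weight
  visibly linear and continuous in \<open>x\<close>.\<close>

lemma box_pts_iff:
  "x \<in> box_pts G \<longleftrightarrow>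
     (\<forall>p. 0 \<le> x p) \<and> {p. x p \<noteq> 0} \<in> box_complex G \<and> (\<Sum>p\<in>pverts G \<times> UNIV. x p) = 1"
proof -
  have "(\<Sum>p | x p \<noteq> 0. x p) = (\<Sum>p\<in>pverts G \<times> UNIV. x p)" if "{p. x p \<noteq> 0} \<in> box_complex G"
    by (rule sum.mono_neutral_left[OF finite_box_verts]) (use box_complex_verts[OF that] in auto)
  then show ?thesis by (auto simp: box_pts_def)
qed

lemma box_pts_sum: "x \<in> box_pts G \<Longrightarrow> (\<Sum>p\<in>pverts G \<times> UNIV. x p) = 1"
  by (simp add: box_pts_iff)

lemma box_pts_le_1:
  assumes "x \<in> box_pts G" shows "x p \<le> 1"
proof (cases "x p = 0")
  case False
  then have "p \<in> pverts G \<times> UNIV" using box_pts_supp[OF assms] by auto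
  then have "x p \<le> (\<Sum>p\<in>pverts G \<times> UNIV. x p)"
    using box_pts_nonneg[OF assms] finite_box_verts by (intro member_le_sum) auto
  then show ?thesis using box_pts_sum[OF assms] by simp
qed auto

lemma box_inv_in_box_pts:
  assumes x: "x \<in> box_pts G" shows "box_inv x \<in> box_pts G"
proof -
  from x have s: "{p. x p \<noteq> 0} \<in> box_complex G" by (simp add: box_pts_iff)
  then have ne: "{p. x p \<noteq> 0} \<noteq> {}" unfolding box_complex_iff by blast
  from s obtain W where W: "\<And>b. W b \<noteq> {}" "joined G (W False) (W True)"
      "\<And>v b. x (v, b) \<noteq> 0 \<Longrightarrow> v \<in> W b"
    by (elim box_complexE) auto
  have "joined G (W True) (W False)" using W(2) arcs_symmetric by (auto simp: joined_def)
  moreover obtain v b where "x (v, b) \<noteq> 0" using ne by auto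
  then have "box_inv x (v, \<not> b) \<noteq> 0" by simp
  then have "{p. box_inv x p \<noteq> 0} \<noteq> {}" by blast
  ultimately have 1: "{p. box_inv x p \<noteq> 0} \<in> box_complex G"
    unfolding box_complex_iff using W(1,3) by (intro conjI exI[of _ "\<lambda>b. W (\<not> b)"]) auto
  have "(\<Sum>p\<in>pverts G \<times> UNIV. box_inv x p) = (\<Sum>p\<in>pverts G \<times> UNIV. x p)"
    by (rule sum.reindex_bij_witness[of _ "\<lambda>(v, b). (v, \<not> b)" "\<lambda>(v, b). (v, \<not> b)"]) auto
  then show ?thesis using x 1 by (auto simp: box_pts_iff)
qed

end

section \<open>Normalization\<close>

definition normalized :: "'v set \<Rightarrow> ('v \<Rightarrow> real) \<Rightarrow> 'v \<Rightarrow> real" where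
  "normalized V y = (\<lambda>p. y p / (\<Sum>q\<in>V. y q))"

abbreviation box_normalized :: "'a pair_pre_digraph \<Rightarrow> ('a \<times> bool \<Rightarrow> real) \<Rightarrow> 'a \<times> bool \<Rightarrow> real" where
  "box_normalized G \<equiv> normalized (pverts G \<times> UNIV)"

text \<open>Points of the cone over \<open>|B(G)|\<close> without its apex. Maps into the
  realization are built from such weights, one coordinate at a time, and divided by the total only
  at the end.\<close>

definition box_weight :: "'a pair_pre_digraph \<Rightarrow> ('a \<times> bool \<Rightarrow> real) \<Rightarrow> bool" where
  "box_weight G y \<longleftrightarrow> (\<forall>p. 0 \<le> y p) \<and> {p. y p \<noteq> 0} \<in> box_complex G"

context pair_pseudo_graph
begin

lemma box_weight_sum_pos:
  assumes "box_weight G y" shows "(\<Sum>p\<in>pverts G \<times> UNIV. y p) > 0"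
proof -
  have s: "{p. y p \<noteq> 0} \<in> box_complex G" using assms by (simp add: box_weight_def)
  then obtain p where "y p \<noteq> 0" by (auto simp: box_complex_iff)
  then show ?thesis using assms box_complex_verts[OF s] finite_box_verts
    by (intro sum_pos2[of _ p]) (auto simp: box_weight_def less_le)
qed

lemma box_normalized_supp:
  "box_weight G y \<Longrightarrow> {p. box_normalized G y p \<noteq> 0} = {p. y p \<noteq> 0}"
  using box_weight_sum_pos[of y] by (auto simp: normalized_def)

lemma box_normalized_in:
  assumes "box_weight G y" shows "box_normalized G y \<in> box_pts G"
proof -
  have "(\<Sum>p\<in>pverts G \<times> UNIV. box_normalized G y p) = 1"
    using box_weight_sum_pos[OF assms] by (simp add: normalized_def sum_divide_distrib[symmetric])
  moreover have "\<forall>p. 0 \<le> box_normalized G y p"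
    using assms box_weight_sum_pos[OF assms] by (auto simp: normalized_def box_weight_def)
  ultimately show ?thesis
    unfolding box_pts_iff box_normalized_supp[OF assms] using assms by (auto simp: box_weight_def)
qed

lemma box_normalized_inv: "box_normalized G (box_inv y) = box_inv (box_normalized G y)"
proof -
  have "(\<Sum>p\<in>pverts G \<times> UNIV. box_inv y p) = (\<Sum>p\<in>pverts G \<times> UNIV. y p)"
    by (rule sum.reindex_bij_witness[of _ "\<lambda>(v, b). (v, \<not> b)" "\<lambda>(v, b). (v, \<not> b)"]) auto
  then show ?thesis by (auto simp: normalized_def fun_eq_iff)
qed

end

text \<open>The totals are positive and continuous, so dividing by them preserves continuity.
  Coordinates outside the vertex set vanish because supports are simplices, which leaves only those
  over \<open>pverts H\<close> to be checked.\<close>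

lemma box_Z2_map_normalized:
  fixes G :: "'a pair_pre_digraph" and H :: "'b pair_pre_digraph"
  assumes H: "pair_pseudo_graph H"
    and w: "\<And>x. x \<in> box_pts G \<Longrightarrow> box_weight H (\<phi> x)"
    and cont: "\<And>p. p \<in> pverts H \<times> UNIV \<Longrightarrow> continuous_on (box_pts G) (\<lambda>x. \<phi> x p)"
    and inv: "\<And>x. x \<in> box_pts G \<Longrightarrow> \<phi> (box_inv x) = box_inv (\<phi> x)"
  shows "box_Z2_map G H (\<lambda>x. box_normalized H (\<phi> x))"
proof -
  interpret H: pair_pseudo_graph H by fact
  have 0: "\<phi> x p = 0" if "x \<in> box_pts G" "p \<notin> pverts H \<times> UNIV" for x p
    using w[OF that(1)] that(2) H.box_complex_verts by (auto simp: box_weight_def)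
  have "continuous_on (box_pts G) (\<lambda>x. \<phi> x p)" for p
  proof (cases "p \<in> pverts H \<times> UNIV")
    case False
    then show ?thesis using 0 by (simp cong: continuous_on_cong)
  qed (rule cont)
  then have "continuous_on (box_pts G) (\<lambda>x. box_normalized H (\<phi> x))"
    unfolding normalized_def using H.box_weight_sum_pos[OF w]
    by (intro continuous_on_coordinatewise_then_product continuous_intros) (auto simp: less_le)
  then show ?thesis
    unfolding box_Z2_map_iff using w inv by (auto simp: H.box_normalized_in H.box_normalized_inv)
qed

section \<open>Homotopies\<close>

text \<open>The segment from \<open>f x\<close> to \<open>g x\<close> stays in the closed simplex
  spanned by the support of \<open>g x\<close>, and \<open>box_inv\<close> acts linearly on
  coordinates; so linear interpolation runs through Z_2-maps.\<close>

lemma box_Z2_homotopic_supp: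
  fixes G :: "'a pair_pre_digraph" and H :: "'b pair_pre_digraph"
  assumes H: "pair_pseudo_graph H" and f: "box_Z2_map G H f" and g: "box_Z2_map G H g"
    and supp: "\<And>x. x \<in> box_pts G \<Longrightarrow> {p. f x p \<noteq> 0} \<subseteq> {p. g x p \<noteq> 0}"
  shows "box_Z2_homotopic G H f g"
proof -
  interpret H: pair_pseudo_graph H by fact
  define h where "h = (\<lambda>(t::real, x) p. (1 - t) * f x p + t * g x p)"
  note [simp] = f[unfolded box_Z2_map_iff, THEN conjunct2, THEN conjunct1, rule_format]
    g[unfolded box_Z2_map_iff, THEN conjunct2, THEN conjunct1, rule_format]
  have h_in: "h (t, x) \<in> box_pts H" if t: "t \<in> {0..1}" and x: "x \<in> box_pts G" for t x
  proof -
    have nn: "0 \<le> f x p" "0 \<le> g x p" for p using x by (simp_all add: H.box_pts_nonneg)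
    have sf: "(\<Sum>p\<in>pverts H \<times> UNIV. f x p) = 1" and sg: "(\<Sum>p\<in>pverts H \<times> UNIV. g x p) = 1"
      using x by (simp_all add: H.box_pts_sum)
    have 1: "(\<Sum>p\<in>pverts H \<times> UNIV. h (t, x) p) = 1"
      by (simp add: h_def sum.distrib sum_distrib_left[symmetric] sf sg)
    have 2: "{p. h (t, x) p \<noteq> 0} \<subseteq> {p. g x p \<noteq> 0}"
      using supp[OF x] by (auto simp: h_def)
    have "{p. h (t, x) p \<noteq> 0} \<noteq> {}"
    proof
      assume "{p. h (t, x) p \<noteq> 0} = {}"
      then have "h (t, x) p = 0" for p by blast
      then show False using 1 by simp
    qed
    moreover have "{p. g x p \<noteq> 0} \<in> box_complex H"
      using x g by (auto simp: box_Z2_map_iff H.box_pts_iff)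
    ultimately have "{p. h (t, x) p \<noteq> 0} \<in> box_complex H"
      using 2 H.box_complex_subset by blast
    moreover have "0 \<le> h (t, x) p" for p using t nn by (simp add: h_def)
    ultimately show ?thesis using 1 by (simp add: H.box_pts_iff)
  qed
  have fc: "continuous_on (box_pts G) f" and gc: "continuous_on (box_pts G) g"
    using f g by (auto simp: box_Z2_map_iff)
  have c: "continuous_on ({0..1} \<times> box_pts G) (\<lambda>z. k (snd z) p)"
    if "continuous_on (box_pts G) k" for k :: "_ \<Rightarrow> 'b \<times> bool \<Rightarrow> real" and p
    by (rule continuous_on_compose2[OF continuous_on_product_then_coordinatewise[OF that]])
      (auto intro: continuous_intros)
  have "continuous_on ({0..1} \<times> box_pts G) h"
    unfolding h_def case_prod_unfold
    by (intro continuous_on_coordinatewise_then_product continuous_intros c[OF fc] c[OF gc])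
  then have cont: "continuous_map (prod_topology (top_of_set {0..1}) (box_space G)) (box_space H) h"
  proof -
    assume h: "continuous_on ({0..1} \<times> box_pts G) h"
    have "continuous_map (prod_topology (top_of_set {0..1}) X) Y h"
      if "X = top_of_set (box_pts G)" "Y = top_of_set (box_pts H)" for X Y
      using h h_in by (auto simp: that continuous_map_in_subtopology)
    then show ?thesis using box_space_eq[of G] box_space_eq[of H] .
  qed
  have "box_Z2_map G H (\<lambda>x. h (t, x))" if t: "t \<in> {0..1}" for t
  proof -
    have "continuous_on (box_pts G) (\<lambda>x. h (t, x))"
      unfolding h_def prod.case
      by (intro continuous_on_coordinatewise_then_product continuous_intros
          fc[THEN continuous_on_product_then_coordinatewise] gc[THEN continuous_on_product_then_coordinatewise])
    moreover have "h (t, box_inv x) = box_inv (h (t, x))" if "x \<in> box_pts G" for x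
      using f g that by (auto simp: box_Z2_map_iff h_def)
    ultimately show ?thesis using h_in[OF t] by (simp add: box_Z2_map_iff)
  qed
  then show ?thesis
    unfolding Z2_homotopic_def homotopic_with_def
    by (intro exI[of _ h] conjI cont) (auto simp: h_def)
qed

lemma box_Z2_map_comp:
  assumes "box_Z2_map F G f" "box_Z2_map G H g"
  shows "box_Z2_map F H (g \<circ> f)"
proof -
  have "continuous_on (box_pts F) (g \<circ> f)"
    using assms unfolding box_Z2_map_iff
    by (intro continuous_on_compose) (auto intro: continuous_on_subset)
  then show ?thesis using assms by (simp add: box_Z2_map_iff)
qed

section \<open>Pushing points of the box complex away from its two shores\<close>

lemma continuous_on_evaluation [continuous_intros]:
  "continuous_on S (\<lambda>x :: 'v \<Rightarrow> 'w :: topological_space. x p)"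
  by (rule continuous_on_subset[OF continuous_on_product_coordinates subset_UNIV])

text \<open>Half of \<open>1 / (2 * card (pverts G))\<close>, which is the least possible average
  coordinate of a side carrying at least half of the total weight; such a side therefore has a
  coordinate above the threshold.\<close>

definition box_threshold :: "'a pair_pre_digraph \<Rightarrow> real" where
  "box_threshold G = 1 / (4 * card (pverts G))"

definition box_mass :: "'a pair_pre_digraph \<Rightarrow> bool \<Rightarrow> ('a \<times> bool \<Rightarrow> real) \<Rightarrow> real" where
  "box_mass G b x = (\<Sum>v\<in>pverts G. x (v, b))"

text \<open>Truncation leaves a margin for adding vertices continuously: the product in
  \<open>box_spread\<close> fades to 0 while the coordinate of an opposite nonneighbour rises to the
  threshold, that is, before this nonneighbour survives truncation.\<close>

definition box_trunc :: "'a pair_pre_digraph \<Rightarrow> ('a \<times> bool \<Rightarrow> real) \<Rightarrow> 'a \<times> bool \<Rightarrow> real" where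
  "box_trunc G x = (\<lambda>(u, b). if u \<in> pverts G then max 0 (x (u, b) - box_threshold G) else 0)"

text \<open>The product is positive iff \<open>u\<close> is adjacent to all vertices whose weight on the opposite side
  reaches the threshold. It only contributes if side \<open>b\<close> carries less than half of the total
  weight, hence never on both sides.\<close>

definition box_spread :: "'a pair_pre_digraph \<Rightarrow> ('a \<times> bool \<Rightarrow> real) \<Rightarrow> 'a \<times> bool \<Rightarrow> real" where
  "box_spread G x = (\<lambda>(u, b). if u \<in> pverts G then box_trunc G x (u, b) +
     max 0 (1 / 2 - box_mass G b x) *
     (\<Prod>v\<in>{v \<in> pverts G. (v, u) \<notin> parcs G}. max 0 (box_threshold G - x (v, \<not> b))) else 0)"

context pair_pseudo_graph
begin

section \<open>Masses, thresholds and truncated points\<close>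

lemma box_mass_add:
  assumes "x \<in> box_pts G" shows "box_mass G b x + box_mass G (\<not> b) x = 1"
proof -
  have "1 = (\<Sum>v\<in>pverts G. \<Sum>b\<in>UNIV. x (v, b))"
    using box_pts_sum[OF assms] by (simp add: sum.cartesian_product)
  also have "\<dots> = box_mass G b x + box_mass G (\<not> b) x"
    by (cases b) (simp_all add: UNIV_bool box_mass_def sum.distrib)
  finally show ?thesis by simp
qed

lemma exceeds_threshold:
  assumes "1 / 2 \<le> box_mass G b x"
  shows "\<exists>u\<in>pverts G. x (u, b) > box_threshold G"
proof (rule ccontr)
  assume "\<not> ?thesis"
  then have le: "x (u, b) \<le> box_threshold G" if "u \<in> pverts G" for u using that by force
  have "box_mass G b x \<le> card (pverts G) * box_threshold G"
    unfolding box_mass_def using sum_bounded_above[OF le, of "pverts G"] by simp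
  also have "\<dots> \<le> 1 / 4" by (simp add: box_threshold_def)
  finally show False using assms by simp
qed

lemma box_trunc_nonneg: "0 \<le> box_trunc G x p"
  by (cases p) (simp add: box_trunc_def)

lemma box_trunc_le_spread: "box_trunc G x p \<le> box_spread G x p"
  by (cases p) (auto simp: box_spread_def box_trunc_def intro!: mult_nonneg_nonneg prod_nonneg)

lemma box_spread_nonneg: "0 \<le> box_spread G x p"
  using box_trunc_nonneg box_trunc_le_spread order_trans by blast

lemma box_threshold_pos: "u \<in> pverts G \<Longrightarrow> box_threshold G > 0"
  using pair_finite_verts by (auto simp: box_threshold_def card_gt_0_iff)

lemma box_trunc_supp: "{p. box_trunc G x p \<noteq> 0} \<subseteq> {p. x p \<noteq> 0}"
proof -
  have "x p \<noteq> 0" if "box_trunc G x p \<noteq> 0" for p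
    using that box_threshold_pos by (cases p) (force simp: box_trunc_def max_def split: if_splits)
  then show ?thesis by blast
qed

lemma box_trunc_weight:
  assumes x: "x \<in> box_pts G" shows "box_weight G (box_trunc G x)"
proof -
  have "1 / 2 \<le> box_mass G False x \<or> 1 / 2 \<le> box_mass G True x"
    using box_mass_add[OF x, of False] by auto
  then obtain u b where "u \<in> pverts G" "x (u, b) > box_threshold G"
    using exceeds_threshold by blast
  then have "box_trunc G x (u, b) \<noteq> 0" by (simp add: box_trunc_def)
  then have ne: "{p. box_trunc G x p \<noteq> 0} \<noteq> {}" by blast
  show ?thesis
    unfolding box_weight_def using box_complex_subset[OF _ box_trunc_supp ne] x box_trunc_nonneg
    by (auto simp: box_pts_iff)
qed

text \<open>A positive weight has two possible sources: the coordinate survives truncation, or the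
  vertex is added by the product.\<close>

lemma box_spread_cases:
  assumes "box_spread G x (u, b) \<noteq> 0"
  obtains "u \<in> pverts G" "x (u, b) > box_threshold G"
  | "u \<in> pverts G" "box_mass G b x < 1 / 2"
    "\<And>v. v \<in> pverts G \<Longrightarrow> x (v, \<not> b) \<ge> box_threshold G \<Longrightarrow> (v, u) \<in> parcs G"
proof -
  have u: "u \<in> pverts G" using assms by (auto simp: box_spread_def split: if_splits)
  show thesis
  proof (cases "x (u, b) > box_threshold G")
    case False
    then have p: "max 0 (1 / 2 - box_mass G b x) *
     (\<Prod>v\<in>{v \<in> pverts G. (v, u) \<notin> parcs G}. max 0 (box_threshold G - x (v, \<not> b))) \<noteq> 0"
      using assms u by (auto simp: box_spread_def box_trunc_def)
    have "(v, u) \<in> parcs G" if "v \<in> pverts G" "x (v, \<not> b) \<ge> box_threshold G" for v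
    proof (rule ccontr)
      assume "(v, u) \<notin> parcs G"
      with that pair_finite_verts
      have "(\<Prod>v\<in>{v \<in> pverts G. (v, u) \<notin> parcs G}. max 0 (box_threshold G - x (v, \<not> b))) = 0"
        by (intro prod_zero) auto
      with p show False by simp
    qed
    moreover have "box_mass G b x < 1 / 2" using p by (auto simp: max_def split: if_splits)
    ultimately show thesis using that(2) u by blast
  qed (use that u in blast)
qed

text \<open>Two surviving vertices are adjacent already in the simplex of \<open>x\<close>; a
  surviving and an added one are adjacent by the choice of the product; two added ones on opposite
  sides would force both masses below one half.\<close>

lemma box_spread_arc:
  assumes x: "x \<in> box_pts G" and u: "box_spread G x (u, b) \<noteq> 0" and w: "box_spread G x (w, \<not> b) \<noteq> 0"
  shows "(u, w) \<in> parcs G"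
proof -
  have "{p. x p \<noteq> 0} \<in> box_complex G" using x by (simp add: box_pts_iff)
  then obtain W where W: "joined G (W False) (W True)" "\<And>v b. x (v, b) \<noteq> 0 \<Longrightarrow> v \<in> W b"
    by (elim box_complexE) auto
  show ?thesis
  proof (cases rule: box_spread_cases[OF u])
    case 1
    note u = this
    show ?thesis
    proof (cases rule: box_spread_cases[OF w])
      case 1
      then have "x (u, b) \<noteq> 0" "x (w, \<not> b) \<noteq> 0"
        using u box_threshold_pos[OF 1(1)] by linarith+
      then show ?thesis using joined_bool W by metis
    next
      case 2
      from 2(3)[of u] u show ?thesis by simp
    qed
  next
    case 2
    note u = this
    show ?thesis
    proof (cases rule: box_spread_cases[OF w])
      case 1
      then show ?thesis using u(3)[of w] arcs_symmetric by simp
    next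
      case 2
      then show ?thesis using u(2) box_mass_add[OF x, of b] by simp
    qed
  qed
qed

text \<open>A side with at least half of the weight has a surviving vertex. On a lighter side every
  element of \<open>W b\<close>, for a complete bipartite pair \<open>W\<close> around the support,
  is added, since its nonneighbours have weight 0 on the opposite side.\<close>

lemma box_spread_both_sides:
  assumes x: "x \<in> box_pts G" shows "\<exists>u. box_spread G x (u, b) \<noteq> 0"
proof (cases "1 / 2 \<le> box_mass G b x")
  case True
  from exceeds_threshold[OF this] obtain u where "u \<in> pverts G" "x (u, b) > box_threshold G"
    by blast
  then have "box_trunc G x (u, b) > 0" by (simp add: box_trunc_def)
  then have "box_spread G x (u, b) > 0" using box_trunc_le_spread order_less_le_trans by blast
  then show ?thesis by (intro exI[of _ u]) simp
next
  case False
  have "{p. x p \<noteq> 0} \<in> box_complex G" using x by (simp add: box_pts_iff)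
  then obtain W where W: "\<And>b. W b \<noteq> {}" "joined G (W False) (W True)"
    "\<And>v b. x (v, b) \<noteq> 0 \<Longrightarrow> v \<in> W b" "\<And>b. W b \<subseteq> pverts G"
    by (elim box_complexE) auto
  obtain u where u: "u \<in> W b" using W(1) by blast
  then have V: "u \<in> pverts G" using W(4) by blast
  have "x (v, \<not> b) = 0" if "(v, u) \<notin> parcs G" for v
    using W(2,3) u that joined_bool[of W v "\<not> b" u] by auto
  then have "(\<Prod>v\<in>{v \<in> pverts G. (v, u) \<notin> parcs G}. max 0 (box_threshold G - x (v, \<not> b))) > 0"
    using box_threshold_pos[OF V] by (intro prod_pos) auto
  then have "box_spread G x (u, b) > 0"
    using False V box_trunc_nonneg[of x "(u, b)"] by (auto simp: box_spread_def intro!: add_nonneg_pos mult_pos_pos)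
  then show ?thesis by (intro exI[of _ u]) simp
qed

lemma box_weight_both_sides:
  assumes "\<And>p. 0 \<le> y p" and "\<And>b. \<exists>u. y (u, b) \<noteq> 0"
    and "\<And>u w. y (u, False) \<noteq> 0 \<Longrightarrow> y (w, True) \<noteq> 0 \<Longrightarrow> (u, w) \<in> parcs G"
  shows "box_weight G y"
proof -
  have "{p. y p \<noteq> 0} \<in> box_complex G"
    unfolding box_complex_iff using assms(2)[of False] assms(2)[of True] assms(3)
    by (intro conjI exI[of _ "\<lambda>b. {u. y (u, b) \<noteq> 0}"]) (auto simp: joined_def)
  then show ?thesis using assms(1) by (simp add: box_weight_def)
qed

lemma box_spread_weight:
  assumes x: "x \<in> box_pts G" shows "box_weight G (box_spread G x)"
  using box_spread_both_sides[OF x] box_spread_arc[OF x, of _ False]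
  by (intro box_weight_both_sides box_spread_nonneg) auto

section \<open>Equivariance and continuity of truncation and spreading\<close>

lemma box_trunc_inv: "box_trunc G (box_inv x) = box_inv (box_trunc G x)"
  by (auto simp: box_trunc_def fun_eq_iff)

lemma box_spread_inv: "box_spread G (box_inv x) = box_inv (box_spread G x)"
  by (auto simp: box_spread_def fun_eq_iff box_trunc_inv box_mass_def)

lemma continuous_box_trunc: "continuous_on S (\<lambda>x. box_trunc G x p)"
  by (cases "fst p \<in> pverts G") (auto simp: box_trunc_def case_prod_unfold intro!: continuous_intros)

lemma continuous_box_spread: "continuous_on S (\<lambda>x. box_spread G x p)"
  by (cases "fst p \<in> pverts G")
    (auto simp: box_spread_def box_mass_def case_prod_unfold intro!: continuous_intros continuous_box_trunc)

lemma box_Z2_map_id: "box_Z2_map G G (\<lambda>x. x)"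
  by (simp add: box_Z2_map_iff)

text \<open>The truncation only shrinks supports, and the support of the spread contains that of the
  truncation; so the spread is homotopic to the identity in two linear steps.\<close>

lemma both_sided_deformation:
  obtains e where "box_Z2_map G G e" "box_Z2_homotopic G G e (\<lambda>x. x)"
    "\<And>x b. x \<in> box_pts G \<Longrightarrow> \<exists>u. e x (u, b) \<noteq> 0"
proof
  let ?t = "\<lambda>x. box_normalized G (box_trunc G x)"
  let ?e = "\<lambda>x. box_normalized G (box_spread G x)"
  have t: "box_Z2_map G G ?t"
    using pair_pseudo_graph by (rule box_Z2_map_normalized)
      (auto simp: box_trunc_weight box_trunc_inv intro: continuous_box_trunc)
  show e: "box_Z2_map G G ?e"
    using pair_pseudo_graph by (rule box_Z2_map_normalized)
      (auto simp: box_spread_weight box_spread_inv intro: continuous_box_spread)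
  have te: "{p. box_trunc G x p \<noteq> 0} \<subseteq> {p. box_spread G x p \<noteq> 0}" for x
  proof -
    have "box_spread G x p \<noteq> 0" if "box_trunc G x p \<noteq> 0" for p
      using that box_trunc_le_spread[of x p] box_trunc_nonneg[of x p] by linarith
    then show ?thesis by blast
  qed
  have "box_Z2_homotopic G G ?t (\<lambda>x. x)"
    using pair_pseudo_graph t box_Z2_map_id by (rule box_Z2_homotopic_supp)
      (use box_trunc_supp in \<open>simp only: box_normalized_supp box_trunc_weight\<close>)
  moreover have "box_Z2_homotopic G G ?t ?e"
    using pair_pseudo_graph t e by (rule box_Z2_homotopic_supp)
      (use te in \<open>simp only: box_normalized_supp box_trunc_weight box_spread_weight\<close>)
  ultimately show "box_Z2_homotopic G G ?e (\<lambda>x. x)"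
    unfolding Z2_homotopic_def by (meson homotopic_with_symD homotopic_with_trans)
  show "\<exists>u. ?e x (u, b) \<noteq> 0" if "x \<in> box_pts G" for x b
    using box_spread_both_sides[OF that, of b] box_normalized_supp[OF box_spread_weight[OF that]]
    by blast
qed

end

section \<open>Compactness\<close>

context pair_pseudo_graph
begin

text \<open>The realization is a product of compact intervals and points, compact by Tychonoff, cut
  down by a finite union of closed sets, one for each simplex.\<close>

lemma compact_box_pts: "compact (box_pts G)" and closed_box_pts: "closed (box_pts G)"
proof -
  let ?V = "pverts G \<times> (UNIV :: bool set)"
  let ?B = "Pi\<^sub>E UNIV (\<lambda>p. if p \<in> ?V then {0..1::real} else {0})"
  \<comment> \<open>Vanishing outside \<open>\<sigma>\<close>, unlike having support exactly
    \<open>\<sigma>\<close>, is a closed condition; the support is then a face of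
    \<open>\<sigma>\<close>, nonempty because the coordinates sum to 1.\<close>
  let ?C = "\<Union>\<sigma>\<in>box_complex G. {x :: 'a \<times> bool \<Rightarrow> real. (\<forall>p. p \<notin> \<sigma> \<longrightarrow> x p = 0) \<and> (\<Sum>p\<in>?V. x p) = 1}"
  have "compactin (product_topology (\<lambda>_. euclidean) UNIV) ?B"
    unfolding compactin_PiE by auto
  then have B: "compact ?B" by (simp add: euclidean_product_topology)
  have fin: "finite (box_complex G)"
  proof (rule finite_subset)
    show "box_complex G \<subseteq> Pow ?V" by (intro subsetI PowI box_complex_verts)
  qed (simp add: finite_box_verts)
  have C: "closed ?C"
  proof (intro closed_UN fin ballI)
    fix \<sigma> :: "('a \<times> bool) set"
    have "closed {x :: 'a \<times> bool \<Rightarrow> real. p \<notin> \<sigma> \<longrightarrow> x p = 0}" for p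
      by (cases "p \<in> \<sigma>") (auto intro!: closed_Collect_eq continuous_intros)
    then have "closed {x :: 'a \<times> bool \<Rightarrow> real. \<forall>p. p \<notin> \<sigma> \<longrightarrow> x p = 0}"
      by (rule closed_Collect_all)
    moreover have "closed {x :: 'a \<times> bool \<Rightarrow> real. (\<Sum>p\<in>?V. x p) = 1}"
      by (intro closed_Collect_eq continuous_intros)
    ultimately show "closed {x :: 'a \<times> bool \<Rightarrow> real. (\<forall>p. p \<notin> \<sigma> \<longrightarrow> x p = 0) \<and> (\<Sum>p\<in>?V. x p) = 1}"
      unfolding Collect_conj_eq by (rule closed_Int)
  qed
  have "box_pts G = ?B \<inter> ?C"
  proof (intro equalityI subsetI)
    fix x assume x: "x \<in> box_pts G"
    have "x p \<in> (if p \<in> ?V then {0..1::real} else {0})" for p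
      using box_pts_nonneg[OF x] box_pts_le_1[OF x] box_pts_supp[OF x] by (auto simp del: mem_Sigma_iff)
    then have "x \<in> ?B" by auto
    moreover have "x \<in> ?C" using x by (auto simp: box_pts_iff)
    ultimately show "x \<in> ?B \<inter> ?C" by blast
  next
    fix x assume x: "x \<in> ?B \<inter> ?C"
    then obtain \<sigma> where s: "\<sigma> \<in> box_complex G" "\<And>p. p \<notin> \<sigma> \<Longrightarrow> x p = 0" "(\<Sum>p\<in>?V. x p) = 1" by blast
    have "{p. x p \<noteq> 0} \<noteq> {}"
    proof
      assume "{p. x p \<noteq> 0} = {}"
      then have "x p = 0" for p by blast
      then show False using s(3) by simp
    qed
    then have "{p. x p \<noteq> 0} \<in> box_complex G"
      using s by (intro box_complex_subset[OF s(1)]) auto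
    moreover have "0 \<le> x p" for p
    proof -
      have "x p \<in> (if p \<in> ?V then {0..1::real} else {0})" using x by blast
      then show ?thesis by (auto split: if_splits)
    qed
    ultimately show "x \<in> box_pts G" using s(3) by (simp add: box_pts_iff)
  qed
  moreover have "closed ?B"
  proof -
    have "?B = {x. \<forall>p. x p \<in> (if p \<in> ?V then {0..1::real} else {0})}"
      unfolding PiE_UNIV_domain Pi_def by (simp only: UNIV_I simp_thms)
    moreover have "closed {x :: 'a \<times> bool \<Rightarrow> real. x p \<in> (if p \<in> ?V then {0..1::real} else {0})}" for p
      using closed_vimage[of "if p \<in> ?V then {0..1::real} else {0}" "\<lambda>x. x p"]
      by (simp add: vimage_def)
    ultimately show ?thesis by (simp only: closed_Collect_all)
  qed
  ultimately show "compact (box_pts G)" "closed (box_pts G)"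
    using compact_Int_closed[OF B C] C by (simp_all only: closed_Int)
qed

end

section \<open>Uniform bounds for Z_2-maps by compactness\<close>

lemma box_Z2_map_continuous_coordinate:
  "box_Z2_map G H f \<Longrightarrow> continuous_on (box_pts G) (\<lambda>x. f x p)"
  unfolding box_Z2_map_iff by (rule continuous_on_product_then_coordinatewise) (rule conjunct1)

text \<open>The mass on side \<open>False\<close> attains a positive minimum on the compact
  realization; half of its average over \<open>pverts H\<close> is a bound that some coordinate must
  exceed. The involution transfers this to side \<open>True\<close>.\<close>

lemma uniformly_both_sided:
  fixes G :: "'a pair_pre_digraph" and H :: "'b pair_pre_digraph"
  assumes G: "pair_pseudo_graph G" and H: "pair_pseudo_graph H" and e: "box_Z2_map G H e"
    and ne: "\<And>x b. x \<in> box_pts G \<Longrightarrow> \<exists>u. e x (u, b) \<noteq> 0"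
  obtains \<delta> where "\<delta> > 0" "\<And>x b. x \<in> box_pts G \<Longrightarrow> \<exists>u\<in>pverts H. e x (u, b) > \<delta>"
proof (cases "box_pts G = {}")
  case True
  then show ?thesis using that[of 1] by auto
next
  case False
  interpret G: pair_pseudo_graph G by fact
  interpret H: pair_pseudo_graph H by fact
  have in_H: "e x \<in> box_pts H" if "x \<in> box_pts G" for x using e that by (simp add: box_Z2_map_iff)
  have "continuous_on (box_pts G) (\<lambda>x. box_mass H False (e x))"
    unfolding box_mass_def by (intro continuous_intros box_Z2_map_continuous_coordinate[OF e])
  then obtain x0 where x0: "x0 \<in> box_pts G"
    and min: "\<And>x. x \<in> box_pts G \<Longrightarrow> box_mass H False (e x0) \<le> box_mass H False (e x)"
    using continuous_attains_inf[OF G.compact_box_pts False] by blast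
  obtain u where u: "e x0 (u, False) \<noteq> 0" using ne x0 by blast
  then have uH: "u \<in> pverts H" using H.box_pts_outside[OF in_H[OF x0], of "(u, False)"] by auto
  have pos: "box_mass H False (e x0) > 0"
    unfolding box_mass_def using u uH H.pair_finite_verts H.box_pts_nonneg[OF in_H[OF x0]]
    by (intro sum_pos2[of _ u]) (auto simp: less_le)
  define \<delta> where "\<delta> = box_mass H False (e x0) / (2 * card (pverts H))"
  have c: "card (pverts H) > 0" using uH H.pair_finite_verts by (auto simp: card_gt_0_iff)
  have d: "\<delta> > 0" using pos c by (simp add: \<delta>_def)
  have F: "\<exists>u\<in>pverts H. e x (u, False) > \<delta>" if x: "x \<in> box_pts G" for x
  proof (rule ccontr)
    assume "\<not> ?thesis"
    then have le: "e x (u, False) \<le> \<delta>" if "u \<in> pverts H" for u using that by force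
    have "box_mass H False (e x0) \<le> card (pverts H) * \<delta>"
      using min[OF x] sum_bounded_above[of "pverts H" "\<lambda>u. e x (u, False)" \<delta>] le
      by (simp add: box_mass_def)
    also have "\<dots> = box_mass H False (e x0) / 2" using c by (auto simp: \<delta>_def)
    finally show False using pos by simp
  qed
  have "\<exists>u\<in>pverts H. e x (u, b) > \<delta>" if x: "x \<in> box_pts G" for x b
  proof (cases b)
    case True
    have "e (box_inv x) (u, False) = e x (u, True)" for u
      using e x by (simp add: box_Z2_map_iff)
    then show ?thesis using F[OF G.box_inv_in_box_pts[OF x]] True by simp
  qed (use F[OF x] in simp)
  then show ?thesis using that d by blast
qed

text \<open>Heine-Cantor with sums of coordinate differences as distances, \<open>D\<close> in the
  source and \<open>E\<close> in the target: on the compact set of pairs with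
  \<open>E z \<ge> \<delta>\<close> the distance \<open>D\<close> has a positive minimum, and closer
  pairs satisfy \<open>E z < \<delta>\<close>.\<close>

lemma box_map_uniformly_continuous:
  fixes G :: "'a pair_pre_digraph" and H :: "'b pair_pre_digraph"
  assumes G: "pair_pseudo_graph G" and H: "pair_pseudo_graph H" and g: "box_Z2_map G H g" and "\<delta> > 0"
  obtains \<epsilon> where "\<epsilon> > 0"
    "\<And>x y p. x \<in> box_pts G \<Longrightarrow> y \<in> box_pts G \<Longrightarrow> (\<And>q. \<bar>x q - y q\<bar> \<le> \<epsilon>) \<Longrightarrow> \<bar>g x p - g y p\<bar> < \<delta>"
proof -
  interpret G: pair_pseudo_graph G by fact
  interpret H: pair_pseudo_graph H by fact
  let ?V = "pverts G \<times> (UNIV :: bool set)" and ?W = "pverts H \<times> (UNIV :: bool set)"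
  let ?S = "box_pts G \<times> box_pts G"
  define D where "D = (\<lambda>z :: ('a \<times> bool \<Rightarrow> real) \<times> ('a \<times> bool \<Rightarrow> real). \<Sum>q\<in>?V. \<bar>fst z q - snd z q\<bar>)"
  define E where "E = (\<lambda>z. \<Sum>p\<in>?W. \<bar>g (fst z) p - g (snd z) p\<bar>)"
  note gp = box_Z2_map_continuous_coordinate[OF g]
  have coord: "continuous_on S (\<lambda>z. fst z q)" "continuous_on S (\<lambda>z. snd z q)"
    for S :: "(('a \<times> bool \<Rightarrow> real) \<times> ('a \<times> bool \<Rightarrow> real)) set" and q
    by (rule continuous_on_product_then_coordinatewise, intro continuous_intros)+
  have "continuous_on ?S (\<lambda>z. g (fst z) p)" "continuous_on ?S (\<lambda>z. g (snd z) p)" for p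
    by (rule continuous_on_compose2[OF gp]; auto intro: continuous_intros)+
  then have contE: "continuous_on ?S E"
    unfolding E_def by (intro continuous_intros)
  have cS: "compact ?S" by (intro compact_Times G.compact_box_pts)
  have "compact (?S \<inter> {z \<in> ?S. \<delta> \<le> E z})"
    using continuous_closed_preimage[OF contE closed_Times[OF G.closed_box_pts G.closed_box_pts] closed_atLeast[of \<delta>]]
    by (intro compact_Int_closed[OF cS]) (simp add: vimage_def Int_def)
  then have cC: "compact {z \<in> ?S. \<delta> \<le> E z}" by (simp add: Int_absorb1 subset_iff)
  have gle: "\<bar>g x p - g y p\<bar> < \<delta>" if "x \<in> box_pts G" "y \<in> box_pts G" "E (x, y) < \<delta>" for x y p
  proof (cases "p \<in> ?W")
    case True
    then have "\<bar>g x p - g y p\<bar> \<le> E (x, y)"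
      unfolding E_def using H.finite_box_verts by (simp, intro member_le_sum) auto
    then show ?thesis using that by simp
  next
    case False
    have "g x \<in> box_pts H" "g y \<in> box_pts H" using g that by (auto simp: box_Z2_map_iff)
    then have "g x p = 0" "g y p = 0" using H.box_pts_outside[OF _ False] by simp_all
    then show ?thesis using \<open>\<delta> > 0\<close> by simp
  qed
  show thesis
  proof (cases "{z \<in> ?S. \<delta> \<le> E z} = {}")
    case True
    have "E (x, y) < \<delta>" if "x \<in> box_pts G" "y \<in> box_pts G" for x y
    proof (rule ccontr)
      assume "\<not> E (x, y) < \<delta>"
      with that have "(x, y) \<in> {z \<in> ?S. \<delta> \<le> E z}" by simp
      with True show False by (simp only: empty_iff)
    qed
    then show ?thesis using gle by (intro that[of 1]) simp_all
  next
    case False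
    have "continuous_on {z \<in> ?S. \<delta> \<le> E z} D" unfolding D_def
      by (intro continuous_intros coord)
    then obtain z0 where z0: "z0 \<in> ?S" "\<delta> \<le> E z0"
      and min: "\<And>z. z \<in> ?S \<Longrightarrow> \<delta> \<le> E z \<Longrightarrow> D z0 \<le> D z"
      using continuous_attains_inf[OF cC False] by blast
    have "fst z0 \<noteq> snd z0" using z0 \<open>\<delta> > 0\<close> by (auto simp: E_def)
    then obtain q where q: "fst z0 q \<noteq> snd z0 q" by blast
    have "q \<in> ?V"
    proof (rule ccontr)
      assume "q \<notin> ?V"
      then have "x q = 0" if "x \<in> box_pts G" for x using G.box_pts_outside that by blast
      then have "fst z0 q = 0" "snd z0 q = 0" using z0(1) by (simp_all add: mem_Times_iff)
      with q show False by simp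
    qed
    then have D0: "D z0 > 0" and cV: "card ?V > 0" unfolding D_def using q G.finite_box_verts
      by (auto intro!: sum_pos2[of _ q] simp del: card_cartesian_product) (auto simp: card_gt_0_iff)
    show ?thesis
    \<comment> \<open>Summed over \<open>?V\<close>, this coordinatewise bound gives at most half of
      the minimal distance.\<close>
    proof (rule that[of "D z0 / (2 * card ?V)"])
      show "D z0 / (2 * card ?V) > 0" using D0 cV by simp
      fix x y p assume xy: "x \<in> box_pts G" "y \<in> box_pts G" and le: "\<And>q. \<bar>x q - y q\<bar> \<le> D z0 / (2 * card ?V)"
      have "D (x, y) \<le> card ?V * (D z0 / (2 * card ?V))"
        unfolding D_def fst_conv snd_conv
        by (rule order_trans[OF sum_bounded_above[OF le[unfolded D_def]]]) simp
      also have "\<dots> = D z0 / 2" using cV by auto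
      finally have "D (x, y) < D z0" using D0 by simp
      then have "E (x, y) < \<delta>" using min[of "(x, y)"] xy by (simp add: not_le[symmetric]) blast
      then show "\<bar>g x p - g y p\<bar> < \<delta>" using gle xy by blast
    qed
  qed
qed

section \<open>The graphs \<open>\<Omega>\<^sub>k(G)\<close>\<close>

lemma Omega_verts_iff:
  "A \<in> Omega_verts k G \<longleftrightarrow> length A = k div 2 + 1 \<and> (\<forall>i\<le>k div 2. A ! i \<subseteq> pverts G) \<and>
     card (A ! 0) = 1 \<and> (\<forall>i\<in>{1..k div 2}. joined G (A ! (i - 1)) (A ! i))"
  by (simp add: Omega_verts_def Let_def)

lemma pverts_Omega [simp]: "pverts (Omega k G) = Omega_verts k G"
  by (simp add: Omega_def Let_def)

lemma arc_Omega_iff: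
  "(A, B) \<in> parcs (Omega k G) \<longleftrightarrow> A \<in> Omega_verts k G \<and> B \<in> Omega_verts k G \<and>
     (\<forall>i\<in>{1..k div 2}. A ! (i - 1) \<subseteq> B ! i \<and> B ! (i - 1) \<subseteq> A ! i) \<and>
     joined G (A ! (k div 2)) (B ! (k div 2))"
  by (simp add: Omega_def Let_def)

context pair_pseudo_graph
begin

lemma joined_sym: "joined G A B \<Longrightarrow> joined G B A"
  using arcs_symmetric by (auto simp: joined_def)

lemma finite_Omega_verts: "finite (Omega_verts k G)"
proof (rule finite_subset)
  show "Omega_verts k G \<subseteq> {A. set A \<subseteq> Pow (pverts G) \<and> length A = k div 2 + 1}"
    by (auto simp: Omega_verts_iff set_conv_nth less_Suc_eq_le subset_iff)
qed (simp add: finite_lists_length_eq pair_finite_verts)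

lemma pair_pseudo_graph_Omega: "pair_pseudo_graph (Omega k G)"
proof
  show "finite (pverts (Omega k G))" by (simp add: finite_Omega_verts)
  show "finite (parcs (Omega k G))"
    by (rule finite_subset[of _ "Omega_verts k G \<times> Omega_verts k G"])
      (auto simp: arc_Omega_iff finite_Omega_verts)
  show "symmetric (with_proj (Omega k G))"
  proof -
    have "(B, A) \<in> parcs (Omega k G)" if "(A, B) \<in> parcs (Omega k G)" for A B
      using that joined_sym[of "A ! (k div 2)" "B ! (k div 2)"] unfolding arc_Omega_iff by simp
    then have "sym (parcs (Omega k G))" by (rule symI)
    then show ?thesis by (simp add: symmetric_def)
  qed
qed (auto simp: arc_Omega_iff)

lemma Omega_proj_in: "A \<in> Omega_verts k G \<Longrightarrow> Omega_proj A \<in> A ! 0"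
  by (auto simp: Omega_verts_iff Omega_proj_def card_1_singleton_iff)

text \<open>Each \<open>A\<^sub>i\<close> is contained in \<open>B\<^sub>i\<^sub>+\<^sub>1\<close>, which is contained in \<open>A\<^sub>i\<^sub>+\<^sub>2\<close>.\<close>

lemma Omega_nbr_subset:
  assumes "(A, B) \<in> parcs (Omega k G)" "i \<le> j" "j \<le> k div 2"
  shows "A ! i \<subseteq> (if even (j - i) then A ! j else B ! j)"
  using assms(2,3)
proof (induction j rule: dec_induct)
  case base
  then show ?case by simp
next
  case (step m)
  have "A ! m \<subseteq> B ! Suc m" "B ! m \<subseteq> A ! Suc m"
    using assms(1) step.prems by (auto simp: arc_Omega_iff dest!: bspec[of _ _ "Suc m"])
  moreover have "A ! i \<subseteq> (if even (m - i) then A ! m else B ! m)"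
    using step.IH step.prems by simp
  moreover have "even (Suc m - i) \<longleftrightarrow> odd (m - i)" using step.hyps by (simp add: Suc_diff_le)
  ultimately show ?case by (cases "even (m - i)") auto
qed

text \<open>According to the parity of \<open>i\<close>, the set \<open>A ! i\<close> contains the
  singleton \<open>A ! 0\<close> or the singleton \<open>B ! 0\<close>. Tuples with an empty entry
  are thus isolated.\<close>

lemma Omega_nbr_nonempty:
  assumes "(A, B) \<in> parcs (Omega k G)" "i \<le> k div 2"
  shows "A ! i \<noteq> {}"
proof -
  have "A ! 0 \<noteq> {}" "B ! 0 \<noteq> {}" using assms(1) by (auto simp: arc_Omega_iff Omega_verts_iff)
  moreover have "(B, A) \<in> parcs (Omega k G)"
    using assms(1) pair_sym_digraph.arcs_symmetric pair_pseudo_graph_Omega pair_pseudo_graph_def by metis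
  ultimately show ?thesis
    using Omega_nbr_subset[OF assms(1), of 0 i] Omega_nbr_subset[of B A k 0 i] assms(2)
    by (cases "even i") auto
qed

end

section \<open>Maps induced by homomorphisms\<close>

lemma box_map_apply:
  assumes F: "pair_pseudo_graph F" and x: "x \<in> box_pts F"
  shows "box_map h x q = (\<Sum>p\<in>{p \<in> pverts F \<times> UNIV. (\<lambda>(v, b). (h v, b)) p = q}. x p)"
proof -
  interpret F: pair_pseudo_graph F by fact
  show ?thesis unfolding box_map_def linear_ext_def
    by (rule sum.mono_neutral_left)
      (use F.box_pts_outside[OF x] F.pair_finite_verts in \<open>auto simp del: mem_Sigma_iff\<close>)
qed

text \<open>Nonnegative weights cannot cancel.\<close>

lemma box_map_nonzero_iff:
  assumes F: "pair_pseudo_graph F" and x: "x \<in> box_pts F"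
  shows "box_map h x (w, b) \<noteq> 0 \<longleftrightarrow> (\<exists>v. x (v, b) \<noteq> 0 \<and> h v = w)"
proof -
  interpret F: pair_pseudo_graph F by fact
  let ?S = "{p \<in> pverts F \<times> UNIV. (\<lambda>(v, b). (h v, b)) p = (w, b)}"
  have "finite ?S" using F.finite_box_verts by simp
  then have "box_map h x (w, b) = 0 \<longleftrightarrow> (\<forall>p\<in>?S. x p = 0)"
    unfolding box_map_apply[OF assms] using F.box_pts_nonneg[OF x] by (intro sum_nonneg_eq_0_iff) auto
  also have "\<dots> \<longleftrightarrow> (\<forall>v\<in>pverts F. h v = w \<longrightarrow> x (v, b) = 0)" by auto
  finally show ?thesis using F.box_pts_outside[OF x] by (metis SigmaE2)
qed

text \<open>A homomorphism carries a complete bipartite pair with nonempty sides to another one, so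
  images of simplices are simplices, including one-sided ones, by
  \<open>box_complex_iff\<close>.\<close>

lemma box_Z2_map_box_map:
  fixes F :: "'a pair_pre_digraph" and H :: "'b pair_pre_digraph"
  assumes F: "pair_pseudo_graph F" and H: "pair_pseudo_graph H" and h: "graph_hom F H h"
  shows "box_Z2_map F H (box_map h)"
proof -
  interpret F: pair_pseudo_graph F by fact
  interpret H: pair_pseudo_graph H by fact
  have hV: "h ` pverts F \<subseteq> pverts H" and harc: "\<And>u v. (u, v) \<in> parcs F \<Longrightarrow> (h u, h v) \<in> parcs H"
    using h by (auto simp: graph_hom_def)
  have "continuous_on (box_pts F) (\<lambda>x. box_map h x q)" for q
  proof -
    have "continuous_on (box_pts F) (\<lambda>x. \<Sum>p\<in>{p \<in> pverts F \<times> UNIV. (\<lambda>(v, b). (h v, b)) p = q}. x p)"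
      by (intro continuous_on_sum continuous_on_evaluation)
    then show ?thesis by (simp add: box_map_apply[OF F] cong: continuous_on_cong)
  qed
  then have cont: "continuous_on (box_pts F) (box_map h)"
    by (rule continuous_on_coordinatewise_then_product)
  have mem: "box_map h x \<in> box_pts H" if x: "x \<in> box_pts F" for x
  proof -
    have s: "{p. x p \<noteq> 0} \<in> box_complex F" using x by (simp add: F.box_pts_iff)
    then obtain W where W: "\<And>b. W b \<noteq> {}" "joined F (W False) (W True)" "\<And>v b. x (v, b) \<noteq> 0 \<Longrightarrow> v \<in> W b"
      by (elim F.box_complexE) auto
    have "{p. x p \<noteq> 0} \<noteq> {}" using s unfolding F.box_complex_iff by blast
    then obtain v b where "x (v, b) \<noteq> 0" by auto
    then have "box_map h x (h v, b) \<noteq> 0" by (auto simp: box_map_nonzero_iff[OF F x])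
    then have ne: "{q. box_map h x q \<noteq> 0} \<noteq> {}" by blast
    have "joined H (h ` W False) (h ` W True)" using W(2) harc by (auto simp: joined_def)
    moreover have "w \<in> h ` W b" if "box_map h x (w, b) \<noteq> 0" for w b
      using that W(3) by (auto simp: box_map_nonzero_iff[OF F x])
    ultimately have "{q. box_map h x q \<noteq> 0} \<in> box_complex H"
      unfolding H.box_complex_iff using ne W(1) by (intro conjI exI[of _ "\<lambda>b. h ` W b"]) auto
    moreover have "0 \<le> box_map h x q" for q
      unfolding box_map_apply[OF F x] using F.box_pts_nonneg[OF x] by (intro sum_nonneg)
    moreover have "(\<Sum>q\<in>pverts H \<times> UNIV. box_map h x q) = 1"
      unfolding box_map_apply[OF F x] using hV F.pair_finite_verts H.pair_finite_verts F.box_pts_sum[OF x]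
      by (subst sum.group) auto
    ultimately show ?thesis by (simp add: H.box_pts_iff)
  qed
  have "box_map h (box_inv x) (w, b) = box_inv (box_map h x) (w, b)" if x: "x \<in> box_pts F" for x w b
    unfolding box_inv_apply box_map_apply[OF F x] box_map_apply[OF F F.box_inv_in_box_pts[OF x]]
    by (rule sum.reindex_bij_witness[of _ "\<lambda>(v, b). (v, \<not> b)" "\<lambda>(v, b). (v, \<not> b)"]) auto
  then show ?thesis
    unfolding box_Z2_map_iff using cont mem by (auto simp: fun_eq_iff simp del: box_inv_apply)
qed

section \<open>From the box complex of \<open>G\<close> to that of \<open>\<Omega>\<^sub>k(G)\<close>\<close>

text \<open>In the vertex \<open>(A, b)\<close> the set \<open>A\<^sub>i\<close> lives on side \<open>b\<close> for even \<open>i\<close> and on the opposite side for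
  odd \<open>i\<close>. The weight of \<open>(A, b)\<close> is positive iff every \<open>A\<^sub>i\<close> with \<open>i \<ge> 1\<close> is between the superlevel
  sets at \<open>level \<delta> l (i - 1)\<close> and \<open>level \<delta> l i\<close> of the given point on the corresponding side, and
  the singleton \<open>A\<^sub>0\<close> is contained in the superlevel set at \<open>level \<delta> l 0\<close>.\<close>

definition level :: "real \<Rightarrow> nat \<Rightarrow> nat \<Rightarrow> real" where
  "level \<delta> l i = \<delta> * (real l + 1 - real i) / (real l + 1)"

definition level_weight ::
    "real \<Rightarrow> nat \<Rightarrow> 'a pair_pre_digraph \<Rightarrow> ('a \<times> bool \<Rightarrow> real) \<Rightarrow> 'a set list \<times> bool \<Rightarrow> real" where
  "level_weight \<delta> k G y = (\<lambda>(A, b). if A \<in> Omega_verts k G then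
     (\<Prod>i\<le>k div 2. \<Prod>v\<in>A ! i. max 0 (y (v, b \<noteq> odd i) - level \<delta> (k div 2) i)) *
     (\<Prod>i\<in>{1..k div 2}. \<Prod>v\<in>pverts G - A ! i. max 0 (level \<delta> (k div 2) (i - 1) - y (v, b \<noteq> odd i)))
     else 0)"

text \<open>The levels fall in equal steps from \<open>\<delta>\<close> at index 0 to
  \<open>\<delta> / (l + 1)\<close> at index \<open>l\<close>, staying positive.\<close>

lemma level_less: "\<delta> > 0 \<Longrightarrow> i < j \<Longrightarrow> level \<delta> l j < level \<delta> l i"
  by (simp add: level_def divide_strict_right_mono)

lemma level_pos: "\<delta> > 0 \<Longrightarrow> i \<le> l \<Longrightarrow> 0 < level \<delta> l i"
  by (simp add: level_def)

lemma level_0: "level \<delta> l 0 = \<delta>"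
  by (simp add: level_def)

context pair_pseudo_graph
begin

lemma finite_Omega_coordinate: "A \<in> Omega_verts k G \<Longrightarrow> i \<le> k div 2 \<Longrightarrow> finite (A ! i)"
  using pair_finite_verts finite_subset unfolding Omega_verts_iff by blast

lemma level_weight_nonneg: "0 \<le> level_weight \<delta> k G y p"
  by (cases p) (auto simp: level_weight_def intro!: mult_nonneg_nonneg prod_nonneg)

lemma level_weight_nonzero_iff:
  "level_weight \<delta> k G y (A, b) \<noteq> 0 \<longleftrightarrow> A \<in> Omega_verts k G \<and>
     (\<forall>i\<le>k div 2. \<forall>v\<in>A ! i. y (v, b \<noteq> odd i) > level \<delta> (k div 2) i) \<and>
     (\<forall>i\<in>{1..k div 2}. \<forall>v\<in>pverts G - A ! i. y (v, b \<noteq> odd i) < level \<delta> (k div 2) (i - 1))"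
proof (cases "A \<in> Omega_verts k G")
  case True
  have m: "max 0 r = 0 \<longleftrightarrow> \<not> 0 < r" for r :: real by auto
  have 1: "(\<Prod>i\<le>k div 2. \<Prod>v\<in>A ! i. max 0 (y (v, b \<noteq> odd i) - level \<delta> (k div 2) i)) \<noteq> 0 \<longleftrightarrow>
    (\<forall>i\<le>k div 2. \<forall>v\<in>A ! i. y (v, b \<noteq> odd i) > level \<delta> (k div 2) i)"
    using finite_Omega_coordinate[OF True] by (simp add: m Ball_def)
  have 2: "(\<Prod>i\<in>{1..k div 2}. \<Prod>v\<in>pverts G - A ! i. max 0 (level \<delta> (k div 2) (i - 1) - y (v, b \<noteq> odd i))) \<noteq> 0 \<longleftrightarrow>
    (\<forall>i\<in>{1..k div 2}. \<forall>v\<in>pverts G - A ! i. y (v, b \<noteq> odd i) < level \<delta> (k div 2) (i - 1))"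
    using pair_finite_verts by (simp add: m)
  show ?thesis using True 1 2 by (simp only: level_weight_def prod.case if_True mult_eq_0_iff) blast
qed (simp add: level_weight_def)

text \<open>Passing from \<open>A\<close> to \<open>B\<close> and from \<open>i - 1\<close> to
  \<open>i\<close> flips the side twice, so both sets concern the same coordinates; an element of
  \<open>A ! (i - 1)\<close> lies above level \<open>i - 1\<close>, whereas all vertices missing
  from \<open>B ! i\<close> lie below it.\<close>

lemma level_weight_nested:
  assumes A: "level_weight \<delta> k G y (A, b) \<noteq> 0" and B: "level_weight \<delta> k G y (B, \<not> b) \<noteq> 0"
    and i: "i \<in> {1..k div 2}"
  shows "A ! (i - 1) \<subseteq> B ! i"
proof
  fix v assume v: "v \<in> A ! (i - 1)"
  have s: "(b \<noteq> odd (i - 1)) = ((\<not> b) \<noteq> odd i)" using i by (cases i) auto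
  have AV: "A \<in> Omega_verts k G" using A by (simp add: level_weight_nonzero_iff)
  have "i - 1 \<le> k div 2" using i unfolding atLeastAtMost_iff by linarith
  then have "v \<in> pverts G" using AV v unfolding Omega_verts_iff by blast
  moreover have "y (v, b \<noteq> odd (i - 1)) > level \<delta> (k div 2) (i - 1)"
    using A v \<open>i - 1 \<le> k div 2\<close> unfolding level_weight_nonzero_iff by blast
  then have "y (v, (\<not> b) \<noteq> odd i) > level \<delta> (k div 2) (i - 1)" by (simp only: s)
  ultimately show "v \<in> B ! i"
    using B i unfolding level_weight_nonzero_iff by (meson DiffI less_asym)
qed

lemma box_pts_arc:
  assumes "y \<in> box_pts G" "y (u, b) \<noteq> 0" "y (w, \<not> b) \<noteq> 0"
  shows "(u, w) \<in> parcs G"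
proof -
  have "{p. y p \<noteq> 0} \<in> box_complex G" using assms(1) by (simp add: box_pts_iff)
  then obtain W where "joined G (W False) (W True)" "\<And>v b. y (v, b) \<noteq> 0 \<Longrightarrow> v \<in> W b"
    by (elim box_complexE) auto
  then show ?thesis using assms(2,3) joined_bool by metis
qed

text \<open>Inclusions come from the nesting. The last level is positive, so the last sets lie in
  the support of \<open>y\<close> on opposite sides and are joined.\<close>

lemma level_weight_arc:
  assumes d: "\<delta> > 0" and y: "y \<in> box_pts G"
    and A: "level_weight \<delta> k G y (A, False) \<noteq> 0" and B: "level_weight \<delta> k G y (B, True) \<noteq> 0"
  shows "(A, B) \<in> parcs (Omega k G)"
proof -
  have "(u, w) \<in> parcs G" if "u \<in> A ! (k div 2)" "w \<in> B ! (k div 2)" for u w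
  proof (rule box_pts_arc[OF y])
    have l: "0 < level \<delta> (k div 2) (k div 2)" using d by (rule level_pos) simp
    have "level \<delta> (k div 2) (k div 2) < y (u, False \<noteq> odd (k div 2))"
      "level \<delta> (k div 2) (k div 2) < y (w, True \<noteq> odd (k div 2))"
      using A B that unfolding level_weight_nonzero_iff by blast+
    with l show "y (u, odd (k div 2)) \<noteq> 0" "y (w, \<not> odd (k div 2)) \<noteq> 0" by auto
  qed
  then show ?thesis
    using A B level_weight_nested[of \<delta> k y A False B] level_weight_nested[of \<delta> k y B True A]
    by (auto simp: arc_Omega_iff joined_def level_weight_nonzero_iff)
qed

text \<open>The strict superlevel sets, with \<open>{u}\<close> in front, form such a tuple:
  vertices left out of \<open>S i\<close> are at most at level \<open>i\<close>, which is strictly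
  below level \<open>i - 1\<close>.\<close>

lemma level_weight_exists:
  assumes d: "\<delta> > 0" and y: "y \<in> box_pts G" and u: "u \<in> pverts G" "y (u, b) > \<delta>"
  shows "\<exists>A. level_weight \<delta> k G y (A, b) \<noteq> 0"
proof -
  let ?l = "k div 2"
  define S where "S i = (if i = 0 then {u} else {v \<in> pverts G. y (v, b \<noteq> odd i) > level \<delta> ?l i})" for i
  define A where "A = map S [0..<?l + 1]"
  have A: "A ! i = S i" if "i \<le> ?l" for i using that by (simp add: A_def del: upt_Suc)
  have up: "level \<delta> ?l i < y (v, b \<noteq> odd i)" if "v \<in> S i" for i v
    using that u by (auto simp: S_def level_0 split: if_splits)
  have "joined G (S (i - 1)) (S i)" if i: "i \<in> {1..?l}" for i
    unfolding joined_def
  proof (intro ballI)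
    fix v w assume v: "v \<in> S (i - 1)" and w: "w \<in> S i"
    have "(b \<noteq> odd (i - 1)) = (\<not> (b \<noteq> odd i))" using i by (cases i) auto
    moreover have "0 < level \<delta> ?l (i - 1)" "0 < level \<delta> ?l i" using d i by (auto intro!: level_pos)
    ultimately have "y (w, \<not> (b \<noteq> odd (i - 1))) \<noteq> 0" "y (v, b \<noteq> odd (i - 1)) \<noteq> 0"
      using up[OF v] up[OF w] by auto
    then show "(v, w) \<in> parcs G" using box_pts_arc[OF y] by blast
  qed
  then have "A \<in> Omega_verts k G"
    using u by (auto simp: Omega_verts_iff A) (auto simp: A_def S_def split: if_splits)
  moreover have "y (v, b \<noteq> odd i) < level \<delta> ?l (i - 1)" if "i \<in> {1..?l}" "v \<in> pverts G" "v \<notin> S i" for i v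
  proof -
    have "y (v, b \<noteq> odd i) \<le> level \<delta> ?l i" using that by (auto simp: S_def)
    also have "\<dots> < level \<delta> ?l (i - 1)" using d that by (intro level_less) auto
    finally show ?thesis .
  qed
  ultimately have "level_weight \<delta> k G y (A, b) \<noteq> 0"
    unfolding level_weight_nonzero_iff using up A by auto
  then show ?thesis ..
qed

section \<open>The Z_2-map into the box complex of \<open>Omega k G\<close>\<close>

lemma level_weight_inv: "level_weight \<delta> k G (box_inv y) = box_inv (level_weight \<delta> k G y)"
proof -
  have "(\<not> (b \<noteq> c)) = ((\<not> b) \<noteq> c)" for b c :: bool by blast
  then show ?thesis by (auto simp only: level_weight_def fun_eq_iff box_inv_apply prod.case split_paired_All)
qed

lemma continuous_level_weight:
  assumes "\<And>p. continuous_on S (\<lambda>x. e x p)"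
  shows "continuous_on S (\<lambda>x. level_weight \<delta> k G (e x) q)"
  by (cases "fst q \<in> Omega_verts k G")
    (auto simp: level_weight_def case_prod_unfold intro!: continuous_intros assms)

lemma box_Z2_map_to_Omega: "\<exists>f. box_Z2_map G (Omega k G) f"
proof -
  obtain e where e: "box_Z2_map G G e" and ne: "\<And>x b. x \<in> box_pts G \<Longrightarrow> \<exists>u. e x (u, b) \<noteq> 0"
    using both_sided_deformation by blast
  obtain \<delta> where d: "\<delta> > 0" "\<And>x b. x \<in> box_pts G \<Longrightarrow> \<exists>u\<in>pverts G. e x (u, b) > \<delta>"
    using uniformly_both_sided[OF pair_pseudo_graph pair_pseudo_graph e ne] by blast
  have in_G: "e x \<in> box_pts G" if "x \<in> box_pts G" for x using e that by (simp add: box_Z2_map_iff)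
  interpret O: pair_pseudo_graph "Omega k G" by (rule pair_pseudo_graph_Omega)
  have "box_Z2_map G (Omega k G) (\<lambda>x. box_normalized (Omega k G) (level_weight \<delta> k G (e x)))"
  proof (rule box_Z2_map_normalized[OF pair_pseudo_graph_Omega])
    fix x assume x: "x \<in> box_pts G"
    show "box_weight (Omega k G) (level_weight \<delta> k G (e x))"
      using level_weight_exists[OF d(1) in_G[OF x]] d(2)[OF x] level_weight_arc[OF d(1) in_G[OF x]]
      by (intro O.box_weight_both_sides level_weight_nonneg) blast+
    show "level_weight \<delta> k G (e (box_inv x)) = box_inv (level_weight \<delta> k G (e x))"
      using e x by (simp add: box_Z2_map_iff level_weight_inv)
  qed (intro continuous_level_weight box_Z2_map_continuous_coordinate[OF e])
  then show ?thesis by blast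
qed

end

section \<open>From the box complex of \<open>\<Omega>\<^sub>k(G)\<close> back to that of \<open>G\<close>\<close>

text \<open>The vertex \<open>(A, b)\<close> is sent to the point whose coordinate at \<open>(v, c)\<close> is proportional to the
  number of sets \<open>A\<^sub>i\<close> on side \<open>c\<close> that contain \<open>v\<close>. Adjacent vertices of \<open>\<Omega>\<^sub>k(G)\<close> have the counts,
  with sides exchanged, differing by at most one, since \<open>A\<^sub>i \<subseteq> B\<^sub>i\<^sub>+\<^sub>1\<close>; as the total count
  is at least \<open>k div 2 + 1\<close>, the images of all vertices of a simplex are close together for large \<open>k\<close>.\<close>

definition occurrences :: "nat \<Rightarrow> 'a set list \<times> bool \<Rightarrow> 'a \<times> bool \<Rightarrow> nat set" where
  "occurrences k = (\<lambda>(A, b) (v, c). {i. i \<le> k div 2 \<and> v \<in> A ! i \<and> c = (b \<noteq> odd i)})"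

definition level_count :: "nat \<Rightarrow> 'a pair_pre_digraph \<Rightarrow> ('a set list \<times> bool \<Rightarrow> real) \<Rightarrow> 'a \<times> bool \<Rightarrow> real" where
  "level_count k G x q = (\<Sum>p\<in>Omega_verts k G \<times> UNIV. x p * card (occurrences k p q))"

lemma finite_occurrences [simp]: "finite (occurrences k p q)"
  by (cases p; cases q) (simp add: occurrences_def)

text \<open>The difference of quotients splits into the change of the numerator over
  \<open>Y\<close> and the factor \<open>z q / Z \<le> 1\<close> times the relative change of the
  total; the totals differ by at most \<open>card V * d\<close>.\<close>

lemma normalized_close:
  fixes y z :: "'v \<Rightarrow> real"
  assumes close: "\<And>q. \<bar>y q - z q\<bar> \<le> d" and nn: "\<And>q. 0 \<le> z q" and fin: "finite V" and q: "q \<in> V"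
    and y: "m \<le> (\<Sum>q\<in>V. y q)" and z: "m \<le> (\<Sum>q\<in>V. z q)" and m: "m > 0"
  shows "\<bar>normalized V y q - normalized V z q\<bar> \<le> (1 + card V) * d / m"
proof -
  define Y Z where "Y = (\<Sum>q\<in>V. y q)" and "Z = (\<Sum>q\<in>V. z q)"
  have pos: "Y > 0" "Z > 0" using y z m by (simp_all add: Y_def Z_def)
  have "\<bar>Z - Y\<bar> = \<bar>\<Sum>q\<in>V. z q - y q\<bar>" by (simp add: Y_def Z_def sum_subtractf)
  also have "\<dots> \<le> (\<Sum>q\<in>V. \<bar>z q - y q\<bar>)" by (rule sum_abs)
  also have "\<dots> \<le> card V * d"
    using sum_bounded_above[of V "\<lambda>q. \<bar>z q - y q\<bar>" d] close by (simp add: abs_minus_commute)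
  finally have ZY: "\<bar>Z - Y\<bar> \<le> card V * d" .
  have zZ: "z q \<le> Z" unfolding Z_def using q fin nn by (intro member_le_sum) auto
  have d: "0 \<le> d" using close[of q] by linarith
  have "y q / Y - z q / Z = (y q - z q) / Y + (z q / Z) * ((Z - Y) / Y)"
    using pos by (simp add: field_simps)
  then have "\<bar>y q / Y - z q / Z\<bar> \<le> \<bar>(y q - z q) / Y\<bar> + \<bar>(z q / Z) * ((Z - Y) / Y)\<bar>"
    by (simp only: abs_triangle_ineq)
  also have "\<dots> = \<bar>y q - z q\<bar> / Y + (z q / Z) * (\<bar>Z - Y\<bar> / Y)"
    using pos nn[of q] by (simp add: abs_mult)
  also have "\<dots> \<le> d / Y + 1 * (card V * d / Y)"
    using pos zZ nn[of q] close[of q] ZY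
    by (intro add_mono mult_mono divide_right_mono) auto
  also have "\<dots> = (1 + card V) * d / Y" using pos by (simp add: field_simps)
  also have "\<dots> \<le> (1 + card V) * d / m"
    using d m y by (intro divide_left_mono) (auto simp: Y_def intro!: mult_nonneg_nonneg mult_pos_pos)
  finally show ?thesis by (simp add: normalized_def Y_def Z_def)
qed

definition vertex_point :: "'v \<Rightarrow> 'v \<Rightarrow> real" where
  "vertex_point p = (\<lambda>q. if q = p then 1 else 0)"

context pair_pseudo_graph
begin

text \<open>An occurrence at index \<open>i\<close> in \<open>A\<close> shifts to index
  \<open>i + 1\<close> in \<open>B\<close>, on the same side since \<open>b\<close> flips together
  with the parity. Only an occurrence at the last index is lost.\<close>

lemma occurrences_arc:
  assumes AB: "(A, B) \<in> parcs (Omega k G)"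
  shows "card (occurrences k (A, b) q) \<le> card (occurrences k (B, \<not> b) q) + 1"
proof -
  obtain v c where q: "q = (v, c)" by fastforce
  let ?S = "occurrences k (A, b) q - {k div 2}"
  have "Suc i \<in> occurrences k (B, \<not> b) q" if "i \<in> ?S" for i
  proof -
    have i: "Suc i \<le> k div 2" "v \<in> A ! i" "c = (b \<noteq> odd i)"
      using that by (auto simp: occurrences_def q)
    then have "Suc i \<in> {1..k div 2}" by simp
    then have "A ! (Suc i - 1) \<subseteq> B ! Suc i" using AB unfolding arc_Omega_iff by blast
    then show ?thesis using i by (auto simp: occurrences_def q)
  qed
  then have "card (Suc ` ?S) \<le> card (occurrences k (B, \<not> b) q)"
    by (intro card_mono) auto
  then have "card ?S \<le> card (occurrences k (B, \<not> b) q)" by (simp add: card_image)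
  moreover have "card (occurrences k (A, b) q) \<le> card ?S + 1"
    using diff_card_le_card_Diff[of "{k div 2}" "occurrences k (A, b) q"] by simp
  ultimately show ?thesis by linarith
qed

text \<open>Vertices of a simplex on opposite shores are adjacent; two on the same shore have a
  common neighbour, and each of the two arcs costs at most one occurrence.\<close>

lemma occurrences_simplex:
  assumes s: "\<sigma> \<in> box_complex (Omega k G)" and p: "p \<in> \<sigma>" "p' \<in> \<sigma>"
  shows "card (occurrences k p q) \<le> card (occurrences k p' q) + 2"
proof -
  interpret O: pair_pseudo_graph "Omega k G" by (rule pair_pseudo_graph_Omega)
  obtain A b A' b' where pp: "p = (A, b)" "p' = (A', b')" by fastforce
  from s obtain W where W: "\<And>b. W b \<noteq> {}" "joined (Omega k G) (W False) (W True)"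
    "\<And>A b. (A, b) \<in> \<sigma> \<Longrightarrow> A \<in> W b" by (elim O.box_complexE) blast
  have A: "A \<in> W b" "A' \<in> W b'" using W(3) p pp by auto
  show ?thesis
  proof (cases "b' = b")
    case True
    obtain B where B: "B \<in> W (\<not> b)" using W(1) by blast
    have "(A, B) \<in> parcs (Omega k G)" "(B, A') \<in> parcs (Omega k G)"
      using O.joined_bool[OF W(2), of A b B] O.joined_bool[OF W(2), of B "\<not> b" A'] A B True by auto
    from occurrences_arc[OF this(1), of b q] occurrences_arc[OF this(2), of "\<not> b" q]
    show ?thesis using True pp by simp
  next
    case False
    then have "(A, A') \<in> parcs (Omega k G)" using O.joined_bool[OF W(2), of A b A'] A by auto
    from occurrences_arc[OF this, of b q] show ?thesis using False pp by auto
  qed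
qed

lemma vertex_point_in:
  assumes "\<sigma> \<in> box_complex G" "p \<in> \<sigma>"
  shows "vertex_point p \<in> box_pts G"
proof -
  have "p \<in> pverts G \<times> UNIV" using assms box_complex_verts by blast
  then have "(\<Sum>q\<in>pverts G \<times> UNIV. vertex_point p q) = 1"
    using finite_box_verts by (simp add: vertex_point_def)
  moreover have "{q. vertex_point p q \<noteq> 0} = {p}" by (auto simp: vertex_point_def)
  ultimately show ?thesis
    using box_complex_subset[OF assms(1), of "{p}"] assms(2)
    unfolding box_pts_iff by (simp add: vertex_point_def)
qed

lemma level_count_vertex_point:
  assumes "p \<in> Omega_verts k G \<times> UNIV"
  shows "level_count k G (vertex_point p) q = card (occurrences k p q)"
proof -
  have "level_count k G (vertex_point p) q =
    (\<Sum>p'\<in>Omega_verts k G \<times> UNIV. if p' = p then real (card (occurrences k p q)) else 0)"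
    unfolding level_count_def by (intro sum.cong) (auto simp: vertex_point_def)
  then show ?thesis using assms finite_Omega_verts by simp
qed

text \<open>\<open>level_count k G x q\<close> is a convex combination of the counts at the vertices
  of the simplex of \<open>x\<close>, which differ pairwise by at most 2.\<close>

lemma level_count_close:
  assumes x: "x \<in> box_pts (Omega k G)" and p: "x p \<noteq> 0"
  shows "\<bar>level_count k G x q - level_count k G (vertex_point p) q\<bar> \<le> 2"
proof -
  interpret O: pair_pseudo_graph "Omega k G" by (rule pair_pseudo_graph_Omega)
  let ?c = "\<lambda>p. real (card (occurrences k p q))"
  have s: "{p. x p \<noteq> 0} \<in> box_complex (Omega k G)" using x by (simp add: O.box_pts_iff)
  have pV: "p \<in> Omega_verts k G \<times> UNIV" using O.box_pts_outside[OF x, of p] p by auto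
  have one: "(\<Sum>p\<in>Omega_verts k G \<times> UNIV. x p) = 1" using O.box_pts_sum[OF x] by simp
  have "?c p = (\<Sum>p'\<in>Omega_verts k G \<times> UNIV. x p' * ?c p)"
    by (simp add: sum_distrib_right[symmetric] one)
  then have "level_count k G x q - ?c p = (\<Sum>p'\<in>Omega_verts k G \<times> UNIV. x p' * (?c p' - ?c p))"
    unfolding level_count_def right_diff_distrib sum_subtractf by (rule arg_cong)
  also have "\<bar>\<dots>\<bar> \<le> (\<Sum>p'\<in>Omega_verts k G \<times> UNIV. x p' * 2)"
  proof (rule order_trans[OF sum_abs], rule sum_mono)
    fix p'
    show "\<bar>x p' * (?c p' - ?c p)\<bar> \<le> x p' * 2"
    proof (cases "x p' = 0")
      case False
      have "\<bar>?c p' - ?c p\<bar> \<le> 2"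
        using occurrences_simplex[OF s, of p p' q] occurrences_simplex[OF s, of p' p q] p False by auto
      then show ?thesis using O.box_pts_nonneg[OF x, of p'] by (simp add: abs_mult mult_left_mono)
    qed simp
  qed
  also have "\<dots> = 2" by (simp add: sum_distrib_right[symmetric] one)
  finally show ?thesis by (simp add: level_count_vertex_point[OF pV])
qed

section \<open>Supports and totals of the counts\<close>

lemma level_count_nonzero_iff:
  assumes x: "x \<in> box_pts (Omega k G)"
  shows "level_count k G x (v, c) \<noteq> 0 \<longleftrightarrow>
    (\<exists>A b i. x (A, b) \<noteq> 0 \<and> i \<le> k div 2 \<and> v \<in> A ! i \<and> c = (b \<noteq> odd i))"
proof -
  interpret O: pair_pseudo_graph "Omega k G" by (rule pair_pseudo_graph_Omega)
  have "level_count k G x (v, c) = 0 \<longleftrightarrow>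
    (\<forall>p\<in>Omega_verts k G \<times> UNIV. x p * card (occurrences k p (v, c)) = 0)"
    unfolding level_count_def using finite_Omega_verts O.box_pts_nonneg[OF x]
    by (intro sum_nonneg_eq_0_iff) auto
  also have "\<dots> \<longleftrightarrow> (\<forall>p. x p = 0 \<or> occurrences k p (v, c) = {})"
  proof -
    have "x p * card (occurrences k p (v, c)) = 0 \<longleftrightarrow> x p = 0 \<or> occurrences k p (v, c) = {}" for p
      by simp
    then show ?thesis using O.box_pts_outside[OF x] unfolding pverts_Omega by metis
  qed
  also have "\<dots> \<longleftrightarrow> \<not> (\<exists>A b i. x (A, b) \<noteq> 0 \<and> i \<le> k div 2 \<and> v \<in> A ! i \<and> c = (b \<noteq> odd i))"
    by (auto simp: occurrences_def)
  finally show ?thesis by blast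
qed

lemma level_count_nonneg: "x \<in> box_pts (Omega k G) \<Longrightarrow> 0 \<le> level_count k G x q"
  unfolding level_count_def using pair_pseudo_graph.box_pts_nonneg[OF pair_pseudo_graph_Omega]
  by (intro sum_nonneg mult_nonneg_nonneg) auto

text \<open>With \<open>l = k div 2\<close>, the sets \<open>A\<^sub>i\<close> with \<open>i\<close> of the parity of \<open>l\<close> lie in \<open>A\<^sub>l\<close> and the others in \<open>B\<^sub>l\<close>
  for a neighbour \<open>B\<close>; so each side of the support lies in the union of the last sets over one shore.\<close>

lemma level_count_weight:
  assumes x: "x \<in> box_pts (Omega k G)"
  shows "box_weight G (level_count k G x)"
proof -
  interpret O: pair_pseudo_graph "Omega k G" by (rule pair_pseudo_graph_Omega)
  let ?l = "k div 2"
  have s: "{p. x p \<noteq> 0} \<in> box_complex (Omega k G)" using x by (simp add: O.box_pts_iff)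
  from s obtain W where W: "\<And>b. W b \<noteq> {}" "joined (Omega k G) (W False) (W True)"
    "\<And>A b. x (A, b) \<noteq> 0 \<Longrightarrow> A \<in> W b" by (elim O.box_complexE) auto
  define L where "L b = (\<Union>A\<in>W b. A ! ?l)" for b
  \<comment> \<open>The last set of a vertex on shore \<open>b\<close> lives on side
    \<open>b \<noteq> odd ?l\<close>; \<open>M\<close> reindexes the unions by that side.\<close>
  define M where "M c = L (c \<noteq> odd ?l)" for c
  have nbr: "\<exists>B\<in>W (\<not> b). (A, B) \<in> parcs (Omega k G)" if "A \<in> W b" for A b
    using W(1)[of "\<not> b"] O.joined_bool[OF W(2) that] by blast
  have Lne: "L b \<noteq> {}" for b
  proof -
    obtain A where A: "A \<in> W b" using W(1) by blast
    obtain B where "(A, B) \<in> parcs (Omega k G)" using nbr[OF A] by blast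
    then have "A ! ?l \<noteq> {}" by (rule Omega_nbr_nonempty) simp
    then show ?thesis using A by (auto simp: L_def)
  qed
  have jL: "joined G (L False) (L True)"
  proof -
    have "joined G (A ! ?l) (B ! ?l)" if "A \<in> W False" "B \<in> W True" for A B
      using O.joined_bool[OF W(2), of A False B] that by (simp add: arc_Omega_iff)
    then show ?thesis by (auto simp: L_def joined_def)
  qed
  then have jM: "joined G (M False) (M True)"
    using joined_sym by (cases "odd ?l") (simp_all add: M_def)
  have mem: "v \<in> M c" if "level_count k G x (v, c) \<noteq> 0" for v c
  proof -
    from that[unfolded level_count_nonzero_iff[OF x]]
    obtain A b i where A: "x (A, b) \<noteq> 0" and i: "i \<le> ?l" "v \<in> A ! i" and c: "c = (b \<noteq> odd i)"
      by (elim exE conjE)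
    obtain B where B: "B \<in> W (\<not> b)" "(A, B) \<in> parcs (Omega k G)" using nbr W(3)[OF A] by blast
    show ?thesis
    proof (cases "even (?l - i)")
      case True
      then have "v \<in> A ! ?l" using Omega_nbr_subset[OF B(2), of i ?l] i by auto
      moreover have "(c \<noteq> odd ?l) = b" using True i c by auto
      ultimately show ?thesis using W(3)[OF A] by (auto simp: M_def L_def)
    next
      case False
      then have "v \<in> B ! ?l" using Omega_nbr_subset[OF B(2), of i ?l] i by auto
      moreover have "(c \<noteq> odd ?l) = (\<not> b)" using False i c by auto
      ultimately show ?thesis using B(1) by (auto simp: M_def L_def)
    qed
  qed
  have "{p. x p \<noteq> 0} \<noteq> {}" using s unfolding O.box_complex_iff by blast
  then obtain A b where A: "x (A, b) \<noteq> 0" by auto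
  obtain B where "(A, B) \<in> parcs (Omega k G)" using nbr W(3)[OF A] by blast
  then obtain v where "v \<in> A ! 0" using Omega_nbr_nonempty by blast
  then have "level_count k G x (v, b) \<noteq> 0"
    unfolding level_count_nonzero_iff[OF x] using A by (intro exI[of _ A] exI[of _ b] exI[of _ 0]) simp
  then have "{q. level_count k G x q \<noteq> 0} \<noteq> {}" by blast
  moreover have "M False \<noteq> {}" "M True \<noteq> {}" using Lne by (simp_all add: M_def)
  ultimately have "{q. level_count k G x q \<noteq> 0} \<in> box_complex G"
    unfolding box_complex_iff using jM mem by (intro conjI exI[of _ M]) auto
  then show ?thesis using level_count_nonneg[OF x] by (simp add: box_weight_def)
qed

text \<open>A tuple in the support has a neighbour, so all its \<open>k div 2 + 1\<close> sets are
  nonempty and each yields an occurrence; the convex combination inherits this bound.\<close>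

lemma level_count_total:
  assumes x: "x \<in> box_pts (Omega k G)"
  shows "real (k div 2) + 1 \<le> (\<Sum>q\<in>pverts G \<times> UNIV. level_count k G x q)"
proof -
  interpret O: pair_pseudo_graph "Omega k G" by (rule pair_pseudo_graph_Omega)
  have s: "{p. x p \<noteq> 0} \<in> box_complex (Omega k G)" using x by (simp add: O.box_pts_iff)
  from s obtain W where W: "\<And>b. W b \<noteq> {}" "joined (Omega k G) (W False) (W True)"
    "\<And>A b. x (A, b) \<noteq> 0 \<Longrightarrow> A \<in> W b" by (elim O.box_complexE) auto
  have c: "k div 2 + 1 \<le> (\<Sum>q\<in>pverts G \<times> UNIV. card (occurrences k (A, b) q))" if A: "x (A, b) \<noteq> 0" for A b
  proof -
    obtain B where "B \<in> W (\<not> b)" using W(1) by blast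
    then have AB: "(A, B) \<in> parcs (Omega k G)" using O.joined_bool[OF W(2) W(3)[OF A]] by blast
    then have "\<forall>i. \<exists>v. i \<le> k div 2 \<longrightarrow> v \<in> A ! i" using Omega_nbr_nonempty by blast
    then obtain v where v: "\<And>i. i \<le> k div 2 \<Longrightarrow> v i \<in> A ! i" by metis
    have vG: "v i \<in> pverts G" if "i \<le> k div 2" for i
      using v[OF that] AB that unfolding arc_Omega_iff Omega_verts_iff by blast
    \<comment> \<open>Recording the index keeps the occurrences apart even when the same vertex is
      chosen for several indices.\<close>
    have "inj_on (\<lambda>i. ((v i, b \<noteq> odd i), i)) {..k div 2}" by (auto intro: inj_onI)
    then have "k div 2 + 1 = card ((\<lambda>i. ((v i, b \<noteq> odd i), i)) ` {..k div 2})" by (simp add: card_image)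
    also have "\<dots> \<le> card (Sigma (pverts G \<times> UNIV) (occurrences k (A, b)))"
      using v vG pair_finite_verts by (intro card_mono finite_SigmaI) (auto simp: occurrences_def)
    also have "\<dots> = (\<Sum>q\<in>pverts G \<times> UNIV. card (occurrences k (A, b) q))"
      using pair_finite_verts by (intro card_SigmaI) auto
    finally show ?thesis .
  qed
  have "real (k div 2 + 1) = (\<Sum>p\<in>Omega_verts k G \<times> UNIV. x p * real (k div 2 + 1))"
    using O.box_pts_sum[OF x] by (simp only: sum_distrib_right[symmetric] pverts_Omega mult_1)
  also have "\<dots> \<le> (\<Sum>p\<in>Omega_verts k G \<times> UNIV. x p * real (\<Sum>q\<in>pverts G \<times> UNIV. card (occurrences k p q)))"
  proof (rule sum_mono)
    fix p
    show "x p * real (k div 2 + 1) \<le> x p * real (\<Sum>q\<in>pverts G \<times> UNIV. card (occurrences k p q))"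
    proof (cases "x p = 0")
      case False
      then show ?thesis using c[of "fst p" "snd p"] O.box_pts_nonneg[OF x, of p]
        by (intro mult_left_mono of_nat_mono) simp_all
    qed simp
  qed
  also have "\<dots> = (\<Sum>q\<in>pverts G \<times> UNIV. level_count k G x q)"
    unfolding level_count_def of_nat_sum sum_distrib_left by (rule sum.swap)
  finally show ?thesis by simp
qed

lemma level_count_inv: "level_count k G (box_inv x) = box_inv (level_count k G x)"
proof -
  have "occurrences k (A, \<not> b) (v, c) = occurrences k (A, b) (v, \<not> c)" for A b and v :: 'a and c
    by (auto simp: occurrences_def)
  then have "level_count k G (box_inv x) (v, c) = level_count k G x (v, \<not> c)" for v c
    unfolding level_count_def
    by (intro sum.reindex_bij_witness[of _ "\<lambda>(v, b). (v, \<not> b)" "\<lambda>(v, b). (v, \<not> b)"]) auto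
  then show ?thesis by (auto simp: fun_eq_iff)
qed

lemma box_Z2_map_level_count:
  "box_Z2_map (Omega k G) G (\<lambda>x. box_normalized G (level_count k G x))"
proof (rule box_Z2_map_normalized[OF pair_pseudo_graph])
  show "continuous_on (box_pts (Omega k G)) (\<lambda>x. level_count k G x q)" for q
    unfolding level_count_def by (intro continuous_intros)
qed (simp_all add: level_count_weight level_count_inv)

text \<open>\<open>normalized_close\<close> with deviation 2 and totals at least
  \<open>k div 2 + 1\<close>. The numerator is independent of \<open>k\<close>, so the bound tends
  to 0 as \<open>k\<close> grows.\<close>

lemma level_count_simplex_diameter:
  assumes x: "x \<in> box_pts (Omega k G)" and p: "x p \<noteq> 0"
  shows "\<bar>box_normalized G (level_count k G x) q - box_normalized G (level_count k G (vertex_point p)) q\<bar>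
    \<le> (1 + card (pverts G \<times> (UNIV :: bool set))) * 2 / (real (k div 2) + 1)"
proof -
  interpret O: pair_pseudo_graph "Omega k G" by (rule pair_pseudo_graph_Omega)
  have "{p. x p \<noteq> 0} \<in> box_complex (Omega k G)" using x by (simp add: O.box_pts_iff)
  then have vp: "vertex_point p \<in> box_pts (Omega k G)" using p by (intro O.vertex_point_in) auto
  have in_G: "box_normalized G (level_count k G y) \<in> box_pts G" if "y \<in> box_pts (Omega k G)" for y
    by (rule box_normalized_in[OF level_count_weight[OF that]])
  show ?thesis
  proof (cases "q \<in> pverts G \<times> UNIV")
    case True
    show ?thesis
      using level_count_close[OF x p] level_count_nonneg[OF vp] level_count_total[OF x] level_count_total[OF vp] True
      by (intro normalized_close[OF _ _ finite_box_verts]) (auto simp del: mem_Sigma_iff)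
  next
    case False
    then have "box_normalized G (level_count k G x) q = 0"
      "box_normalized G (level_count k G (vertex_point p)) q = 0"
      using box_pts_outside[OF in_G[OF x]] box_pts_outside[OF in_G[OF vp]] by blast+
    then show ?thesis by simp
  qed
qed

section \<open>The projection homomorphism to \<open>G\<close>\<close>

lemma Omega_proj_pverts: "A \<in> Omega_verts k G \<Longrightarrow> Omega_proj A \<in> pverts G"
  using Omega_proj_in[of A k] by (auto simp: Omega_verts_iff)

text \<open>If \<open>k div 2 > 0\<close>, then \<open>B ! 0\<close> lies in \<open>A ! 1\<close>,
  which is joined to \<open>A ! 0\<close>; otherwise the last sets are the singletons
  themselves.\<close>

lemma graph_hom_Omega_proj: "graph_hom (Omega k G) G Omega_proj"
proof -
  have "(Omega_proj A, Omega_proj B) \<in> parcs G" if AB: "(A, B) \<in> parcs (Omega k G)" for A B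
  proof -
    have V: "A \<in> Omega_verts k G" "B \<in> Omega_verts k G" using AB by (auto simp: arc_Omega_iff)
    show ?thesis
    proof (cases "k div 2 = 0")
      case True
      then show ?thesis using AB V[THEN Omega_proj_in] by (auto simp: arc_Omega_iff joined_def)
    next
      case False
      then have one: "1 \<in> {1..k div 2}" by simp
      then have "B ! (1 - 1) \<subseteq> A ! 1" "joined G (A ! (1 - 1)) (A ! 1)"
        using AB V unfolding arc_Omega_iff Omega_verts_iff by blast+
      then show ?thesis using V[THEN Omega_proj_in] by (auto simp: joined_def)
    qed
  qed
  then show ?thesis by (auto simp: graph_hom_def Omega_proj_pverts)
qed

end


section \<open>Approximation of \<open>\<int>\<^sub>2\<close>-maps by homomorphisms\<close>

text \<open>Midpoint of an edge of the box complex; the side tags keep its ends distinct even for a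
  loop. It reduces the preservation of an arc to a statement about the support of one image
  point.\<close>

lemma edge_point_in:
  assumes "pair_pseudo_graph G" and uv: "(u, v) \<in> parcs G"
  shows "(\<lambda>q. if q \<in> {(u, False), (v, True)} then 1 / 2 else 0) \<in> box_pts G" (is "?x \<in> _")
proof -
  interpret pair_pseudo_graph G by fact
  have V: "u \<in> pverts G" "v \<in> pverts G" using uv in_arcsD1 in_arcsD2 by auto
  have "{p. ?x p \<noteq> 0} = {(u, False), (v, True)}" by auto
  moreover have "{(u, False), (v, True)} \<in> box_complex G"
    unfolding box_complex_iff using uv
    by (intro conjI exI[of _ "\<lambda>b. if b then {v} else {u}"]) (auto simp: joined_def)
  moreover have "(\<Sum>p\<in>pverts G \<times> UNIV. ?x p) = (\<Sum>p\<in>{(u, False), (v, True)}. 1 / 2)"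
    using V pair_finite_verts by (intro sum.mono_neutral_cong_right) auto
  ultimately show ?thesis unfolding box_pts_iff by simp
qed

text \<open>The condition \<open>ne\<close> concerns isolated vertices: if \<open>H\<close> were
  empty and \<open>G\<close> had only isolated vertices, any function would be a Z_2-map between the
  empty realizations, but the nonempty \<open>Omega k G\<close> would have no homomorphism to
  \<open>H\<close>.\<close>

lemma box_Z2_map_approximation:
  fixes G :: "'a pair_pre_digraph" and H :: "'b pair_pre_digraph"
  assumes G: "pair_pseudo_graph G" and H: "pair_pseudo_graph H"
    and ne: "pverts H = {} \<longrightarrow> pverts G = {}" and f: "box_Z2_map G H f"
  obtains k h where "odd k" "graph_hom (Omega k G) H h"
    "box_Z2_homotopic (Omega k G) H (box_map h) (f \<circ> box_map Omega_proj)"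
proof -
  interpret G: pair_pseudo_graph G by fact
  interpret H: pair_pseudo_graph H by fact
  obtain e where e: "box_Z2_map H H e" and e_id: "box_Z2_homotopic H H e (\<lambda>x. x)"
    and e_ne: "\<And>x b. x \<in> box_pts H \<Longrightarrow> \<exists>u. e x (u, b) \<noteq> 0"
    using H.both_sided_deformation by blast
  define g where "g = e \<circ> f"
  have g: "box_Z2_map G H g" unfolding g_def by (rule box_Z2_map_comp[OF f e])
  have "\<exists>u. g x (u, b) \<noteq> 0" if "x \<in> box_pts G" for x b
    using e_ne f that by (simp add: g_def box_Z2_map_iff)
  then obtain \<delta> where d: "\<delta> > 0" "\<And>x b. x \<in> box_pts G \<Longrightarrow> \<exists>u\<in>pverts H. g x (u, b) > \<delta>"
    using uniformly_both_sided[OF G H g] by blast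
  obtain \<epsilon> where \<epsilon>: "\<epsilon> > 0" "\<And>x y p. x \<in> box_pts G \<Longrightarrow> y \<in> box_pts G \<Longrightarrow>
      (\<And>q. \<bar>x q - y q\<bar> \<le> \<epsilon>) \<Longrightarrow> \<bar>g x p - g y p\<bar> < \<delta>"
    using box_map_uniformly_continuous[OF G H g d(1)] by blast
  \<comment> \<open>The numerator in \<open>level_count_simplex_diameter\<close>; \<open>l\<close>
    is then taken so large that the whole bound is at most \<open>\<epsilon>\<close>.\<close>
  define C where "C = real ((1 + card (pverts G \<times> (UNIV :: bool set))) * 2)"
  obtain l :: nat where l: "C / \<epsilon> < l" using reals_Archimedean2 by blast
  define k where "k = 2 * l + 1"
  have k: "odd k" "k div 2 = l" by (simp_all add: k_def)
  have "C < l * \<epsilon>" using l \<epsilon>(1) by (simp add: pos_divide_less_eq)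
  also have "\<dots> \<le> \<epsilon> * (real l + 1)" using \<epsilon>(1) by (simp add: algebra_simps)
  finally have Cl: "C / (real l + 1) \<le> \<epsilon>" by (simp add: pos_divide_le_eq)
  let ?O = "Omega k G"
  have O: "pair_pseudo_graph ?O" by (rule G.pair_pseudo_graph_Omega)
  interpret O: pair_pseudo_graph ?O by (rule O)
  define s where "s x = box_normalized G (level_count k G x)" for x
  have s: "box_Z2_map ?O G s" unfolding s_def by (rule G.box_Z2_map_level_count)
  have s_in: "s x \<in> box_pts G" if "x \<in> box_pts ?O" for x using s that by (simp add: box_Z2_map_iff)
  \<comment> \<open>Only the vertex on side \<open>False\<close> is consulted, so that
    \<open>h A\<close> depends on \<open>A\<close> alone; side \<open>True\<close> follows by
    equivariance. If \<open>vertex_point (A, False)\<close> is not a point of the realization, then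
    \<open>A\<close> is isolated and any vertex of \<open>H\<close> will do.\<close>
  define good where "good A u \<longleftrightarrow> u \<in> pverts H \<and>
    (vertex_point (A, False) \<in> box_pts ?O \<longrightarrow> g (s (vertex_point (A, False))) (u, False) > \<delta>)" for A u
  define h where "h A = (SOME u. good A u)" for A
  have good: "good A (h A)" if A: "A \<in> Omega_verts k G" for A
  proof -
    have "\<exists>u. good A u"
    proof (cases "vertex_point (A, False) \<in> box_pts ?O")
      case True
      then show ?thesis using d(2)[OF s_in[OF True], of False] unfolding good_def by blast
    next
      case False
      \<comment> \<open>The element of \<open>A ! 0\<close> shows that \<open>G\<close> is nonempty,
        so \<open>ne\<close> supplies a default vertex of \<open>H\<close>.\<close>
      have "pverts G \<noteq> {}" using G.Omega_proj_pverts[OF A] by blast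
      then show ?thesis using ne False unfolding good_def by blast
    qed
    then show ?thesis unfolding h_def by (rule someI_ex)
  qed
  have supp: "g (s x) (h A, b) \<noteq> 0" if x: "x \<in> box_pts ?O" and A: "x (A, b) \<noteq> 0" for x A b
  proof -
    have \<sigma>: "{p. x p \<noteq> 0} \<in> box_complex ?O" using x by (simp add: O.box_pts_iff)
    then have v: "vertex_point (A, b) \<in> box_pts ?O" using A by (intro O.vertex_point_in) auto
    have AV: "A \<in> Omega_verts k G" using O.box_pts_outside[OF x, of "(A, b)"] A by auto
    have "g (s (vertex_point (A, b))) (h A, b) > \<delta>"
    proof (cases b)
      case False
      then show ?thesis using good[OF AV] v by (simp add: good_def)
    next
      case True
      have inv: "vertex_point (A, False) = box_inv (vertex_point (A, True))"
        by (auto simp: vertex_point_def fun_eq_iff)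
      then have "vertex_point (A, False) \<in> box_pts ?O" using O.box_inv_in_box_pts v True by simp
      moreover have "g (s (vertex_point (A, False))) = box_inv (g (s (vertex_point (A, True))))"
        using s g v True s_in by (simp add: inv box_Z2_map_iff)
      ultimately show ?thesis using good[OF AV] True by (simp add: good_def)
    qed
    moreover have "\<bar>s x q - s (vertex_point (A, b)) q\<bar> \<le> \<epsilon>" for q
      using G.level_count_simplex_diameter[OF x A, of q] Cl unfolding k s_def C_def by linarith
    then have "\<bar>g (s x) (h A, b) - g (s (vertex_point (A, b))) (h A, b)\<bar> < \<delta>"
      using \<epsilon>(2) s_in x v by blast
    ultimately show ?thesis by linarith
  qed
  have gs: "box_Z2_map ?O H (g \<circ> s)" by (rule box_Z2_map_comp[OF s g])
  have hom: "graph_hom ?O H h"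
    unfolding graph_hom_def
  proof (intro conjI allI impI)
    show "h ` pverts ?O \<subseteq> pverts H" using good by (auto simp: good_def)
    fix A B assume AB: "(A, B) \<in> parcs ?O"
    let ?x = "\<lambda>q. if q \<in> {(A, False), (B, True)} then 1 / 2 else (0 :: real)"
    have x: "?x \<in> box_pts ?O" by (rule edge_point_in[OF O AB])
    then have "g (s ?x) \<in> box_pts H" using gs by (simp add: box_Z2_map_iff)
    moreover have "g (s ?x) (h A, False) \<noteq> 0" "g (s ?x) (h B, \<not> False) \<noteq> 0"
      by (rule supp[OF x]; simp)+
    ultimately show "(h A, h B) \<in> parcs H" by (rule H.box_pts_arc)
  qed
  have hmap: "box_Z2_map ?O H (box_map h)" by (rule box_Z2_map_box_map[OF O H hom])
  have pmap: "box_Z2_map ?O G (box_map Omega_proj)"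
    by (rule box_Z2_map_box_map[OF O G G.graph_hom_Omega_proj])
  \<comment> \<open>The chain is \<open>box_map h\<close>, \<open>g \<circ> s\<close>,
    \<open>f \<circ> s\<close>, \<open>f \<circ> box_map Omega_proj\<close>: a linear homotopy in
    \<open>|B(H)|\<close>, then the deformation \<open>e\<close> undone, then the image under
    \<open>f\<close> of a linear homotopy in \<open>|B(G)|\<close>.\<close>
  have 1: "box_Z2_homotopic ?O H (box_map h) (g \<circ> s)"
  proof (rule box_Z2_homotopic_supp[OF H hmap gs])
    fix x assume x: "x \<in> box_pts ?O"
    have "(g \<circ> s) x (w, b) \<noteq> 0" if "box_map h x (w, b) \<noteq> 0" for w b
      using that supp[OF x] unfolding box_map_nonzero_iff[OF O x] by auto
    then show "{p. box_map h x p \<noteq> 0} \<subseteq> {p. (g \<circ> s) x p \<noteq> 0}" by auto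
  qed
  have fs: "box_Z2_map ?O H (f \<circ> s)" by (rule box_Z2_map_comp[OF s f])
  then have "continuous_map (box_space ?O) (box_space H) (f \<circ> s)" by (simp add: Z2_map_def)
  then have "box_Z2_homotopic ?O H (e \<circ> (f \<circ> s)) ((\<lambda>x. x) \<circ> (f \<circ> s))"
    unfolding Z2_homotopic_def
    by (rule homotopic_with_compose_continuous_map_right[OF e_id[unfolded Z2_homotopic_def]])
      (rule box_Z2_map_comp[OF fs])
  then have 2: "box_Z2_homotopic ?O H (g \<circ> s) (f \<circ> s)" by (simp add: g_def comp_def)
  have "box_Z2_homotopic ?O G (box_map Omega_proj) s"
  proof (rule box_Z2_homotopic_supp[OF G pmap s])
    fix x assume x: "x \<in> box_pts ?O"
    \<comment> \<open>The vertex \<open>v\<close> is counted at index 0, where the parity leaves the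
      side \<open>b\<close> unchanged.\<close>
    have "s x (v, b) \<noteq> 0" if v: "box_map Omega_proj x (v, b) \<noteq> 0" for v b
    proof -
      obtain A where A: "x (A, b) \<noteq> 0" "Omega_proj A = v"
        using v unfolding box_map_nonzero_iff[OF O x] by blast
      have "A \<in> Omega_verts k G" using O.box_pts_outside[OF x, of "(A, b)"] A by auto
      then have "v \<in> A ! 0" using G.Omega_proj_in A(2) by blast
      then have "level_count k G x (v, b) \<noteq> 0"
        unfolding G.level_count_nonzero_iff[OF x] using A(1)
        by (intro exI[of _ A] exI[of _ b] exI[of _ 0]) simp
      then show ?thesis
        using G.box_normalized_supp[OF G.level_count_weight[OF x]] unfolding s_def by blast
    qed
    then show "{p. box_map Omega_proj x p \<noteq> 0} \<subseteq> {p. s x p \<noteq> 0}" by auto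
  qed
  moreover have "continuous_map (box_space G) (box_space H) f" using f by (simp add: Z2_map_def)
  ultimately have "box_Z2_homotopic ?O H (f \<circ> box_map Omega_proj) (f \<circ> s)"
    unfolding Z2_homotopic_def
    by (rule homotopic_with_compose_continuous_map_left) (rule box_Z2_map_comp[OF _ f])
  then have "box_Z2_homotopic ?O H (box_map h) (f \<circ> box_map Omega_proj)"
    using 1 2 unfolding Z2_homotopic_def by (meson homotopic_with_symD homotopic_with_trans)
  then show thesis using that k(1) hom by blast
qed

theorem theorem1p2:
  fixes G :: "'a pair_pre_digraph" and H :: "'b pair_pre_digraph"
  assumes "pair_pseudo_graph G" and "pair_pseudo_graph H"
    and "pverts H = {} \<longrightarrow> pverts G = {}"
  shows "((\<exists>f. box_Z2_map G H f) \<longleftrightarrow> (\<exists>k. odd k \<and> (\<exists>h. graph_hom (Omega k G) H h))) \<and>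
    (pair_loopfree_digraph G \<and> pair_loopfree_digraph H \<longrightarrow>
      (\<forall>f. box_Z2_map G H f \<longrightarrow>
        (\<exists>k h. odd k \<and> graph_hom (Omega k G) H h \<and>
          box_Z2_homotopic (Omega k G) H (box_map h) (f \<circ> box_map Omega_proj))))"
proof -
  interpret G: pair_pseudo_graph G by fact
  have approx: "\<exists>k h. odd k \<and> graph_hom (Omega k G) H h \<and>
      box_Z2_homotopic (Omega k G) H (box_map h) (f \<circ> box_map Omega_proj)" if "box_Z2_map G H f" for f
    using box_Z2_map_approximation[OF assms that] by blast
  have "\<exists>f. box_Z2_map G H f" if "graph_hom (Omega k G) H h" for k h
  proof -
    obtain f where "box_Z2_map G (Omega k G) f" using G.box_Z2_map_to_Omega by blast
    from box_Z2_map_comp[OF this box_Z2_map_box_map[OF G.pair_pseudo_graph_Omega assms(2) that]]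
    show ?thesis by blast
  qed
  then show ?thesis using approx by blast
qed

end
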